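(* Let $P\subseteq[0,1]^n$ be a rational polyhedron and $A$ a subalgebra of $\mathcal M(P)$. Then the following are equivalent: (i) $A=\mathcal M(P)$; (ii) $A$ is isomorphic (as an MV-algebra) to $\mathcal M(P)$ and $A$ is a separating subalgebra of $\mathcal M(P)$; (iii) $A$ is isomorphic to $\mathcal M(P)$ and $A$ is an epi-subalgebra of $\mathcal M(P)$.
   Context: A McNaughton function on $[0,1]^n$ is a continuous function $f\colon[0,1]^n\to[0,1]$ for which there are finitely many affine functions with integer coefficients $p_1,\ldots,p_m$ such that for every $x$ there is $j$ with $f(x)=p_j(x)$. For a nonempty closed $Y\subseteq[0,1]^n$, $\mathcal M(Y)$ denotes the MV-algebra of restrictions to $Y$ of McNaughton functions on $[0,1]^n$, with pointwise operations $f\oplus g=\min(1,f+g)$, $\neg f=1-f$, $0$ the zero function. A rational polyhedron in $[0,1]^n$ is a subset of $[0,1]^n$ which is a finite union of simplexes with rational vertices. A subalgebra $A$ of $\mathcal M(P)$ is separating if for all $x\neq y$ in $P$ there is $f\in A$ with $f(x)\neq f(y)$. $A$ is an epi-subalgebra of $\mathcal M(P)$ if for any MV-algebra $C$ and MV-homomorphisms $h,g\colon\mathcal M(P)\to C$ agreeing on $A$, one has $h=g$. *)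

theory Defs
  imports "HOL-Analysis.Analysis" "HOL-Algebra.Congruence"
begin
record 'a mv_structure = "'a partial_object" +
  mv_plus :: "'a \<Rightarrow> 'a \<Rightarrow> 'a" (infixl "\<oplus>\<index>" 65)
  mv_neg :: "'a \<Rightarrow> 'a" ("\<sim>\<index> _" [81] 80)
  mv_zero :: 'a ("\<zero>\<index>")

text \<open>The trivial one-element algebra is allowed.\<close>

locale mv_algebra =
  fixes C (structure)
  assumes plus_closed: "\<lbrakk>x \<in> carrier C; y \<in> carrier C\<rbrakk> \<Longrightarrow> x \<oplus> y \<in> carrier C"
    and neg_closed: "x \<in> carrier C \<Longrightarrow> \<sim> x \<in> carrier C"
    and zero_closed: "\<zero> \<in> carrier C"
    and plus_assoc: "\<lbrakk>x \<in> carrier C; y \<in> carrier C; z \<in> carrier C\<rbrakk>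
      \<Longrightarrow> (x \<oplus> y) \<oplus> z = x \<oplus> (y \<oplus> z)"
    and plus_comm: "\<lbrakk>x \<in> carrier C; y \<in> carrier C\<rbrakk> \<Longrightarrow> x \<oplus> y = y \<oplus> x"
    and plus_zero: "x \<in> carrier C \<Longrightarrow> x \<oplus> \<zero> = x"
    and neg_neg: "x \<in> carrier C \<Longrightarrow> \<sim> (\<sim> x) = x"
    and plus_neg_zero: "x \<in> carrier C \<Longrightarrow> x \<oplus> (\<sim> \<zero>) = \<sim> \<zero>"
    and lukasiewicz: "\<lbrakk>x \<in> carrier C; y \<in> carrier C\<rbrakk>
      \<Longrightarrow> (\<sim> ((\<sim> x) \<oplus> y)) \<oplus> y = (\<sim> ((\<sim> y) \<oplus> x)) \<oplus> x"

definition mv_hom :: "'a mv_structure \<Rightarrow> 'b mv_structure \<Rightarrow> ('a \<Rightarrow> 'b) set" where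
  "mv_hom B C = {h \<in> carrier B \<rightarrow> carrier C.
     h \<zero>\<^bsub>B\<^esub> = \<zero>\<^bsub>C\<^esub>
     \<and> (\<forall>x\<in>carrier B. h (\<sim>\<^bsub>B\<^esub> x) = \<sim>\<^bsub>C\<^esub> (h x))
     \<and> (\<forall>x\<in>carrier B. \<forall>y\<in>carrier B. h (x \<oplus>\<^bsub>B\<^esub> y) = h x \<oplus>\<^bsub>C\<^esub> h y)}"

definition mv_isomorphic :: "'a mv_structure \<Rightarrow> 'b mv_structure \<Rightarrow> bool" where
  "mv_isomorphic B C \<longleftrightarrow> (\<exists>h\<in>mv_hom B C. bij_betw h (carrier B) (carrier C))"

definition mv_subalgebra :: "'a set \<Rightarrow> 'a mv_structure \<Rightarrow> bool" where
  "mv_subalgebra A B \<longleftrightarrow> A \<subseteq> carrier B \<and> \<zero>\<^bsub>B\<^esub> \<in> A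
     \<and> (\<forall>x\<in>A. \<sim>\<^bsub>B\<^esub> x \<in> A) \<and> (\<forall>x\<in>A. \<forall>y\<in>A. x \<oplus>\<^bsub>B\<^esub> y \<in> A)"

abbreviation mv_restrict :: "'a mv_structure \<Rightarrow> 'a set \<Rightarrow> 'a mv_structure" where
  "mv_restrict B A \<equiv> B\<lparr>carrier := A\<rparr>"

text \<open>
  HOL cannot quantify over types inside a formula, so the type of the elements of the test
  algebras \<open>C\<close> is a parameter. The carrier of \<open>C\<close> is an arbitrary subset of that type.
  A finite type has room for too few test algebras, so the notion is meant for infinite \<open>'c\<close>.
\<close>

definition epi_subalgebra :: "'c itself \<Rightarrow> 'a set \<Rightarrow> 'a mv_structure \<Rightarrow> bool" where
  "epi_subalgebra (T :: 'c itself) A B \<longleftrightarrow> mv_subalgebra A B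
     \<and> (\<forall>C :: 'c mv_structure. mv_algebra C \<longrightarrow>
          (\<forall>h\<in>mv_hom B C. \<forall>g\<in>mv_hom B C.
             (\<forall>a\<in>A. h a = g a) \<longrightarrow> (\<forall>b\<in>carrier B. h b = g b)))"

abbreviation unit_cube :: "(real^'n) set" where
  "unit_cube \<equiv> cbox 0 1"

definition integer_affine :: "(real^'n \<Rightarrow> real) \<Rightarrow> bool" where
  "integer_affine p \<longleftrightarrow> (\<exists>(a :: int^'n) (b :: int).
     p = (\<lambda>x. (\<Sum>i\<in>UNIV. of_int (a $ i) * x $ i) + of_int b))"

text \<open>The values of the function outside the unit cube are irrelevant.\<close>

definition mcnaughton :: "(real^'n \<Rightarrow> real) \<Rightarrow> bool" where
  "mcnaughton f \<longleftrightarrow> continuous_on unit_cube f \<and> f \<in> unit_cube \<rightarrow> {0..1}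
     \<and> (\<exists>F. finite F \<and> (\<forall>p\<in>F. integer_affine p) \<and> (\<forall>x\<in>unit_cube. \<exists>p\<in>F. f x = p x))"

text \<open>
  Functions on \<open>Y\<close> are represented by functions that are \<open>undefined\<close> outside \<open>Y\<close>, so that
  equality in the carrier is equality on \<open>Y\<close>.
\<close>

definition mcn_algebra :: "(real^'n) set \<Rightarrow> (real^'n \<Rightarrow> real) mv_structure" where
  "mcn_algebra Y = \<lparr>carrier = {restrict f Y | f. mcnaughton f},
     mv_plus = (\<lambda>f g. \<lambda>x\<in>Y. min 1 (f x + g x)),
     mv_neg = (\<lambda>f. \<lambda>x\<in>Y. 1 - f x),
     mv_zero = (\<lambda>x\<in>Y. 0)\<rparr>"

definition rational_simplex :: "(real^'n) set \<Rightarrow> bool" where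
  "rational_simplex S \<longleftrightarrow> (\<exists>V. finite V \<and> V \<noteq> {} \<and> \<not> affine_dependent V
     \<and> (\<forall>v\<in>V. \<forall>i. v $ i \<in> \<rat>) \<and> S = convex hull V)"

definition rational_polyhedron :: "(real^'n) set \<Rightarrow> bool" where
  "rational_polyhedron P \<longleftrightarrow> P \<subseteq> unit_cube
     \<and> (\<exists>\<S>. finite \<S> \<and> (\<forall>S\<in>\<S>. rational_simplex S) \<and> P = \<Union>\<S>)"

definition separating :: "'a set \<Rightarrow> ('a \<Rightarrow> real) set \<Rightarrow> bool" where
  "separating P A \<longleftrightarrow> (\<forall>x\<in>P. \<forall>y\<in>P. x \<noteq> y \<longrightarrow> (\<exists>f\<in>A. f x \<noteq> f y))"

lemma integer_affine_const: "integer_affine (\<lambda>x. of_int c)"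
  unfolding integer_affine_def by (rule exI[of _ 0], rule exI[of _ c]) simp

lemma integer_affine_add:
  assumes "integer_affine p" "integer_affine q"
  shows "integer_affine (\<lambda>x. p x + q x)"
proof -
  from assms obtain a b c d where
    "p = (\<lambda>x. (\<Sum>i\<in>UNIV. of_int (a $ i) * x $ i) + of_int b)"
    "q = (\<lambda>x. (\<Sum>i\<in>UNIV. of_int (c $ i) * x $ i) + of_int d)"
    unfolding integer_affine_def by blast
  then have "(\<lambda>x. p x + q x) =
      (\<lambda>x. (\<Sum>i\<in>UNIV. of_int ((a + c) $ i) * x $ i) + of_int (b + d))"
    by (auto simp: sum.distrib algebra_simps)
  then show ?thesis unfolding integer_affine_def by blast
qed

lemma integer_affine_uminus:
  assumes "integer_affine p"
  shows "integer_affine (\<lambda>x. - p x)"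
proof -
  from assms obtain a b where
    "p = (\<lambda>x. (\<Sum>i\<in>UNIV. of_int (a $ i) * x $ i) + of_int b)"
    unfolding integer_affine_def by blast
  then have "(\<lambda>x. - p x) = (\<lambda>x. (\<Sum>i\<in>UNIV. of_int ((- a) $ i) * x $ i) + of_int (- b))"
    by (auto simp: sum_negf)
  then show ?thesis unfolding integer_affine_def by blast
qed

lemma mcnaughton_zero: "mcnaughton (\<lambda>x. 0)"
  unfolding mcnaughton_def using integer_affine_const[of 0]
  by (auto intro!: exI[of _ "{\<lambda>x. 0}"])

lemma mcnaughton_neg:
  assumes "mcnaughton f" shows "mcnaughton (\<lambda>x. 1 - f x)"
proof -
  from assms obtain F where F: "finite F" "\<forall>p\<in>F. integer_affine p"
    "\<forall>x\<in>unit_cube. \<exists>p\<in>F. f x = p x" unfolding mcnaughton_def by blast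
  have "integer_affine (\<lambda>x. 1 - p x)" if "p \<in> F" for p
    using integer_affine_add[OF integer_affine_const[of 1] integer_affine_uminus[of p]] F(2) that
    by simp
  then have "\<exists>G. finite G \<and> (\<forall>p\<in>G. integer_affine p) \<and> (\<forall>x\<in>unit_cube. \<exists>p\<in>G. 1 - f x = p x)"
    using F by (intro exI[of _ "(\<lambda>p x. 1 - p x) ` F"]) fastforce
  then show ?thesis using assms unfolding mcnaughton_def
    by (auto intro!: continuous_intros simp: Pi_iff)
qed

lemma mcnaughton_plus:
  assumes "mcnaughton f" "mcnaughton g" shows "mcnaughton (\<lambda>x. min 1 (f x + g x))"
proof -
  from assms(1) obtain F where F: "finite F" "\<forall>p\<in>F. integer_affine p"
    "\<forall>x\<in>unit_cube. \<exists>p\<in>F. f x = p x" unfolding mcnaughton_def by blast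
  from assms(2) obtain G where G: "finite G" "\<forall>p\<in>G. integer_affine p"
    "\<forall>x\<in>unit_cube. \<exists>p\<in>G. g x = p x" unfolding mcnaughton_def by blast
  let ?H = "insert (\<lambda>x. 1) ((\<lambda>(p, q) x. p x + q x) ` (F \<times> G))"
  have "finite ?H" using F(1) G(1) by simp
  moreover have "\<forall>p\<in>?H. integer_affine p"
    using F(2) G(2) integer_affine_add integer_affine_const[of 1] by auto
  moreover have "\<exists>p\<in>?H. min 1 (f x + g x) = p x" if "x \<in> unit_cube" for x
  proof (cases "f x + g x \<le> 1")
    case True
    from F(3) G(3) that obtain p q where "p \<in> F" "f x = p x" "q \<in> G" "g x = q x" by blast
    then show ?thesis using True by (intro bexI[of _ "\<lambda>x. p x + q x"]) (auto simp: image_iff)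
  qed auto
  ultimately have "\<exists>H. finite H \<and> (\<forall>p\<in>H. integer_affine p)
      \<and> (\<forall>x\<in>unit_cube. \<exists>p\<in>H. min 1 (f x + g x) = p x)" by blast
  then show ?thesis using assms unfolding mcnaughton_def
    by (auto intro!: continuous_intros simp: Pi_iff)
qed

lemma mcn_algebra_mv_algebra:
  assumes "Y \<subseteq> unit_cube"
  shows "mv_algebra (mcn_algebra Y)"
proof -
  have bd: "0 \<le> f x" "f x \<le> 1" if "f \<in> carrier (mcn_algebra Y)" "x \<in> Y" for f x
    using that assms by (auto simp: mcn_algebra_def mcnaughton_def Pi_iff)
  have ext: "restrict f Y = f" if "f \<in> carrier (mcn_algebra Y)" for f
    using that by (auto simp: mcn_algebra_def)
  have ops: "f \<oplus>\<^bsub>mcn_algebra Y\<^esub> g = (\<lambda>x\<in>Y. min 1 (f x + g x))"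
    "\<sim>\<^bsub>mcn_algebra Y\<^esub> f = (\<lambda>x\<in>Y. 1 - f x)"
    "\<zero>\<^bsub>mcn_algebra Y\<^esub> = (\<lambda>x\<in>Y. 0)" for f g
    by (simp_all add: mcn_algebra_def)
  show ?thesis
  proof (standard, goal_cases)
    case (1 f g)
    then obtain f' g' where "f = restrict f' Y" "mcnaughton f'" "g = restrict g' Y" "mcnaughton g'"
      by (auto simp: mcn_algebra_def)
    then show ?case
      using mcnaughton_plus[of f' g'] by (auto simp: mcn_algebra_def cong: restrict_cong)
  next
    case (2 f)
    then obtain f' where "f = restrict f' Y" "mcnaughton f'" by (auto simp: mcn_algebra_def)
    then show ?case
      using mcnaughton_neg[of f'] by (auto simp: mcn_algebra_def cong: restrict_cong)
  next
    case 3
    then show ?case using mcnaughton_zero by (auto simp: mcn_algebra_def)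
  next
    case (4 f g h)
    show ?case unfolding ops
      by (rule restrict_ext) (use bd(1)[OF 4(1)] bd(1)[OF 4(3)] in \<open>fastforce simp: min_def\<close>)
  next
    case (5 f g)
    then show ?case unfolding ops by (simp add: add.commute)
  next
    case (6 f)
    have "(\<lambda>x\<in>Y. min 1 (f x + (\<lambda>x\<in>Y. 0) x)) = restrict f Y"
      by (rule restrict_ext) (use bd[OF 6] in simp)
    then show ?case unfolding ops using ext[OF 6] by simp
  next
    case (7 f)
    have "(\<lambda>x\<in>Y. 1 - (\<lambda>x\<in>Y. 1 - f x) x) = restrict f Y"
      by (rule restrict_ext) simp
    then show ?case unfolding ops using ext[OF 7] by simp
  next
    case (8 f)
    show ?case unfolding ops by (rule restrict_ext) (use bd[OF 8] in simp)
  next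
    case (9 f g)
    show ?case unfolding ops
      by (rule restrict_ext) (use bd[OF 9(1)] bd[OF 9(2)] in \<open>simp add: min_def\<close>)
  qed
qed

end

theory Submission
  imports Defs
begin

text \<open>
  Let \<open>\<psi>\<close> be the inverse of an isomorphism from \<open>A\<close> onto the algebra of \<open>P\<close>. Since every McNaughton
  function is a clipped max-min combination of integer affine functions, \<open>\<psi>\<close> is determined by the
  images of the coordinate functions: it is composition with a piecewise integer affine map
  \<open>g : P \<rightarrow> P\<close>, so that \<open>A\<close> consists of the functions \<open>f \<circ> g\<close>. If \<open>A\<close> separates points, then \<open>g\<close> is
  injective. For each \<open>d\<close> the finitely many points of \<open>P\<close> with denominator dividing \<open>d\<close> are mapped into
  themselves, hence permuted, so \<open>g\<close> preserves denominators. On a rational polytope \<open>T\<close> on which \<open>g\<close>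
  and \<open>f\<close> are affine, Kronecker's criterion then yields an integer affine \<open>p\<close> with \<open>f = p \<circ> g\<close>. Adding
  a large multiple of a function vanishing exactly on the rational polytope \<open>g(T)\<close> makes \<open>p \<circ> g\<close> an
  upper bound of \<open>f\<close> on all of \<open>P\<close>, and \<open>f\<close> is the minimum of these finitely many upper bounds.

  For the epi-subalgebras, evaluations at two points that \<open>A\<close> does not separate are distinct
  homomorphisms which agree on \<open>A\<close>. They take values in a countable subalgebra of \<open>[0,1]\<close>, which
  can be transported to any infinite type.
\<close>

section \<open>Integer affine and piecewise integer affine functions\<close>

lemma integer_affine_sum:
  assumes "finite I" "\<And>i. i \<in> I \<Longrightarrow> integer_affine (u i)"
  shows "integer_affine (\<lambda>x. \<Sum>i\<in>I. u i x)"
  using assms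
proof (induction I rule: finite_induct)
  case empty
  then show ?case using integer_affine_const[of 0] by simp
next
  case (insert i I)
  then show ?case using integer_affine_add[of "u i" "\<lambda>x. \<Sum>i\<in>I. u i x"] by simp
qed

lemma integer_affine_cmult:
  assumes "integer_affine p"
  shows "integer_affine (\<lambda>x. of_int c * p x)"
proof -
  from assms obtain a b where
    "p = (\<lambda>x. (\<Sum>i\<in>UNIV. of_int (a $ i) * x $ i) + of_int b)"
    unfolding integer_affine_def by blast
  then have "(\<lambda>x. of_int c * p x) = (\<lambda>x. (\<Sum>i\<in>UNIV. of_int ((\<chi> i. c * a $ i) $ i) * x $ i) + of_int (c * b))"
    by (auto simp: algebra_simps sum_distrib_left)
  then show ?thesis unfolding integer_affine_def by blast
qed

lemma sum_axis_mult:
  fixes x :: "real^'n"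
  shows "(\<Sum>j\<in>UNIV. of_int ((axis i 1 :: int^'n) $ j) * x $ j) = x $ i"
proof -
  have "(\<Sum>j\<in>UNIV. of_int ((axis i 1 :: int^'n) $ j) * x $ j) = (\<Sum>j\<in>UNIV. if j = i then x $ j else 0)"
    by (intro sum.cong refl) (auto simp: axis_def)
  then show ?thesis by simp
qed

lemma integer_affine_coord:
  fixes i :: "'n::finite"
  shows "integer_affine (\<lambda>x. x $ i)"
proof -
  have "(\<lambda>x::real^'n. x $ i) = (\<lambda>x. (\<Sum>j\<in>UNIV. of_int ((axis i 1 :: int^'n) $ j) * x $ j) + of_int 0)"
    by (simp add: sum_axis_mult)
  then show ?thesis unfolding integer_affine_def by blast
qed

lemma integer_affine_inner:
  assumes "integer_affine p"
  obtains a b where "\<And>x. p x = a \<bullet> x + b"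
proof -
  from assms obtain a b where
    p: "p = (\<lambda>x. (\<Sum>i\<in>UNIV. of_int (a $ i) * x $ i) + of_int b)"
    unfolding integer_affine_def by blast
  have "p x = (\<chi> i. of_int (a $ i)) \<bullet> x + of_int b" for x
    by (simp add: p inner_vec_def)
  then show ?thesis using that by blast
qed

lemma integer_affine_continuous: "integer_affine p \<Longrightarrow> continuous_on S p"
proof -
  assume "integer_affine p"
  then obtain a b where "\<And>x. p x = a \<bullet> x + b" using integer_affine_inner by blast
  then have "p = (\<lambda>x. a \<bullet> x + b)" by blast
  then show ?thesis by (auto intro!: continuous_intros)
qed

lemma integer_affine_combination:
  assumes "integer_affine p" "finite V" "sum \<mu> V = 1"
  shows "p (\<Sum>v\<in>V. \<mu> v *\<^sub>R v) = (\<Sum>v\<in>V. \<mu> v * p v)"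
proof -
  obtain a b where p: "\<And>x. p x = a \<bullet> x + b" using integer_affine_inner assms(1) by blast
  have "(\<Sum>v\<in>V. \<mu> v * p v) = (\<Sum>v\<in>V. \<mu> v * (a \<bullet> v)) + sum \<mu> V * b"
    by (simp add: p algebra_simps sum.distrib sum_distrib_left)
  then show ?thesis by (simp add: p inner_sum_right assms(3))
qed

lemma integer_affine_le_on_hull:
  assumes "integer_affine p" "\<And>v. v \<in> V \<Longrightarrow> p v \<le> 0" "x \<in> convex hull V"
  shows "p x \<le> 0"
proof -
  obtain a b where p: "\<And>x. p x = a \<bullet> x + b" using integer_affine_inner assms(1) by blast
  have "convex {x. a \<bullet> x \<le> - b}" by (rule convex_halfspace_le)
  moreover have "V \<subseteq> {x. a \<bullet> x \<le> - b}" using assms(2) by (force simp: p)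
  ultimately have "convex hull V \<subseteq> {x. a \<bullet> x \<le> - b}" by (simp add: subset_hull)
  then show ?thesis using assms(3) by (auto simp: p)
qed

lemma integer_affine_diff:
  assumes "integer_affine p" "integer_affine q"
  shows "integer_affine (\<lambda>x. p x - q x)"
  using integer_affine_add[OF assms(1) integer_affine_uminus[OF assms(2)]] by simp

lemma integer_affine_compose:
  fixes G :: "real^'n \<Rightarrow> real^'m"
  assumes "integer_affine p" "\<And>i. integer_affine (\<lambda>x. G x $ i)"
  shows "integer_affine (\<lambda>x. p (G x))"
proof -
  from assms(1) obtain a b where
    p: "p = (\<lambda>x. (\<Sum>i\<in>UNIV. of_int (a $ i) * x $ i) + of_int b)"
    unfolding integer_affine_def by blast
  show ?thesis unfolding p
    by (intro integer_affine_add integer_affine_sum integer_affine_cmult integer_affine_const assms(2)) simp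
qed

lemma integer_affine_Ints:
  assumes "integer_affine p" "\<And>i. s * x $ i \<in> \<int>" "s \<in> \<int>"
  shows "s * p x \<in> \<int>"
proof -
  from assms(1) obtain a b where
    p: "p = (\<lambda>x. (\<Sum>i\<in>UNIV. of_int (a $ i) * x $ i) + of_int b)"
    unfolding integer_affine_def by blast
  have "s * p x = (\<Sum>i\<in>UNIV. of_int (a $ i) * (s * x $ i)) + s * of_int b"
    by (simp add: p algebra_simps sum_distrib_left)
  moreover have "(\<Sum>i\<in>UNIV. of_int (a $ i) * (s * x $ i)) \<in> \<int>"
    by (rule Ints_sum) (rule Ints_mult[OF Ints_of_int assms(2)])
  ultimately show ?thesis using assms(3) by (simp add: Ints_mult)
qed

lemma integer_affine_Rats:
  assumes "integer_affine p" "\<And>i. x $ i \<in> \<rat>"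
  shows "p x \<in> \<rat>"
proof -
  from assms(1) obtain a b where
    p: "p = (\<lambda>x. (\<Sum>i\<in>UNIV. of_int (a $ i) * x $ i) + of_int b)"
    unfolding integer_affine_def by blast
  show ?thesis unfolding p by (intro Rats_add Rats_sum Rats_mult Rats_of_int assms(2))
qed

text \<open>Max-min combinations of integer affine functions. The inductive form, rather than
  continuity with finitely many pieces, is what the later structural inductions use: cutting
  polytopes and evaluating characters.\<close>

inductive int_pl :: "(real^'n \<Rightarrow> real) \<Rightarrow> bool" where
  affine: "integer_affine p \<Longrightarrow> int_pl p"
| max: "int_pl f \<Longrightarrow> int_pl g \<Longrightarrow> int_pl (\<lambda>x. max (f x) (g x))"
| min: "int_pl f \<Longrightarrow> int_pl g \<Longrightarrow> int_pl (\<lambda>x. min (f x) (g x))"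

lemma int_pl_uminus: "int_pl f \<Longrightarrow> int_pl (\<lambda>x. - f x)"
proof (induction rule: int_pl.induct)
  case (max f g)
  then show ?case using int_pl.min[OF max.IH] by (simp add: minus_max_eq_min)
next
  case (min f g)
  then show ?case using int_pl.max[OF min.IH] by (simp add: minus_min_eq_max)
qed (simp add: int_pl.affine integer_affine_uminus)

text \<open>Adding a fixed function distributes over max and min, so an outer induction on
  \<open>f\<close> leaves an affine \<open>f\<close>, and an inner induction on \<open>g\<close>
  finishes.\<close>

lemma int_pl_add:
  assumes "int_pl f" "int_pl g"
  shows "int_pl (\<lambda>x. f x + g x)"
  using assms
proof (induction arbitrary: g rule: int_pl.induct)
  case (affine p)
  show ?case using affine.prems
  proof (induction rule: int_pl.induct)
    case (affine q)
    then show ?case using \<open>integer_affine p\<close> by (simp add: int_pl.affine integer_affine_add)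
  next
    case (max f g)
    then show ?case using int_pl.max[OF max.IH] by (simp add: max_add_distrib_right)
  next
    case (min f g)
    then show ?case using int_pl.min[OF min.IH] by (simp add: min_add_distrib_right)
  qed
next
  case (max f1 f2)
  then show ?case using int_pl.max[OF max.IH(1)[of g] max.IH(2)[of g]] by (simp add: max_add_distrib_left)
next
  case (min f1 f2)
  then show ?case using int_pl.min[OF min.IH(1)[of g] min.IH(2)[of g]] by (simp add: min_add_distrib_left)
qed

lemma int_pl_const: "int_pl (\<lambda>x. of_int c)"
  by (simp add: int_pl.affine integer_affine_const)

lemma int_pl_nat_mult: "int_pl f \<Longrightarrow> int_pl (\<lambda>x. real n * f x)"
proof (induction n)
  case 0
  then show ?case using int_pl_const[of 0] by simp
next
  case (Suc n)
  then show ?case using int_pl_add[of "\<lambda>x. real n * f x" f] by (simp add: algebra_simps)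
qed

lemma int_pl_int_mult:
  assumes "int_pl f"
  shows "int_pl (\<lambda>x. of_int c * f x)"
proof (cases "c \<ge> 0")
  case True
  then show ?thesis using int_pl_nat_mult[OF assms, of "nat c"] by simp
next
  case False
  then show ?thesis using int_pl_uminus[OF int_pl_nat_mult[OF assms, of "nat (- c)"]] by simp
qed

lemma int_pl_sum:
  assumes "finite I" "\<And>i. i \<in> I \<Longrightarrow> int_pl (u i)"
  shows "int_pl (\<lambda>x. \<Sum>i\<in>I. u i x)"
  using assms
proof (induction I rule: finite_induct)
  case empty
  then show ?case using int_pl_const[of 0] by simp
next
  case (insert i I)
  then show ?case using int_pl_add[of "u i" "\<lambda>x. \<Sum>i\<in>I. u i x"] by simp
qed

lemma int_pl_Max:
  assumes "finite I" "I \<noteq> {}" "\<And>i. i \<in> I \<Longrightarrow> int_pl (u i)"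
  shows "int_pl (\<lambda>x. MAX i\<in>I. u i x)"
  using assms
proof (induction I rule: finite_ne_induct)
  case (insert i I)
  then show ?case using int_pl.max[of "u i" "\<lambda>x. MAX i\<in>I. u i x"] by simp
qed simp

lemma int_pl_Min:
  assumes "finite I" "I \<noteq> {}" "\<And>i. i \<in> I \<Longrightarrow> int_pl (u i)"
  shows "int_pl (\<lambda>x. MIN i\<in>I. u i x)"
  using assms
proof (induction I rule: finite_ne_induct)
  case (insert i I)
  then show ?case using int_pl.min[of "u i" "\<lambda>x. MIN i\<in>I. u i x"] by simp
qed simp

text \<open>Only the affine case has content: an integer combination of piecewise integer affine
  coordinates is again of that kind. Max and min commute with substitution.\<close>

lemma int_pl_compose:
  fixes g :: "real^'n \<Rightarrow> real^'m"
  assumes "int_pl \<phi>" and g: "\<And>i. int_pl (\<lambda>x. g x $ i)"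
  shows "int_pl (\<lambda>x. \<phi> (g x))"
  using assms(1)
proof (induction rule: int_pl.induct)
  case (affine p)
  then obtain a b where
    p: "p = (\<lambda>x. (\<Sum>i\<in>UNIV. of_int (a $ i) * x $ i) + of_int b)"
    unfolding integer_affine_def by blast
  show ?case unfolding p
    by (intro int_pl_add int_pl_sum int_pl_int_mult int_pl_const g) simp
qed (auto intro: int_pl.intros)

lemma int_pl_continuous: "int_pl f \<Longrightarrow> continuous_on S f"
  by (induction rule: int_pl.induct) (auto intro: continuous_intros integer_affine_continuous)

lemma int_pl_pieces:
  assumes "int_pl f"
  shows "\<exists>F. finite F \<and> (\<forall>p\<in>F. integer_affine p) \<and> (\<forall>x. \<exists>p\<in>F. f x = p x)"
  using assms
proof (induction rule: int_pl.induct)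
  case (affine p)
  then show ?case by (intro exI[of _ "{p}"]) auto
next
  case (max f g)
  then obtain F G where "finite F" "\<forall>p\<in>F. integer_affine p" "\<forall>x. \<exists>p\<in>F. f x = p x"
    "finite G" "\<forall>p\<in>G. integer_affine p" "\<forall>x. \<exists>p\<in>G. g x = p x" by blast
  then show ?case by (intro exI[of _ "F \<union> G"]) (auto simp: max_def)
next
  case (min f g)
  then obtain F G where "finite F" "\<forall>p\<in>F. integer_affine p" "\<forall>x. \<exists>p\<in>F. f x = p x"
    "finite G" "\<forall>p\<in>G. integer_affine p" "\<forall>x. \<exists>p\<in>G. g x = p x" by blast
  then show ?case by (intro exI[of _ "F \<union> G"]) (auto simp: min_def)
qed

text \<open>Truncation to the unit interval; it turns every \<open>int_pl\<close> function into a
  McNaughton function.\<close>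

definition clip :: "real \<Rightarrow> real" where
  "clip t = max 0 (min 1 t)"

lemma clip_id: "0 \<le> t \<Longrightarrow> t \<le> 1 \<Longrightarrow> clip t = t"
  by (simp add: clip_def)

lemma int_pl_clip: "int_pl f \<Longrightarrow> int_pl (\<lambda>x. clip (f x))"
  unfolding clip_def using int_pl_const[of 0] int_pl_const[of 1] by (auto intro: int_pl.intros)

lemma mcnaughton_clip:
  assumes "int_pl f"
  shows "mcnaughton (\<lambda>x. clip (f x))"
proof -
  have "(\<lambda>x. clip (f x)) \<in> unit_cube \<rightarrow> {0..1}" by (auto simp: clip_def)
  then show ?thesis using int_pl_pieces[OF int_pl_clip[OF assms]] int_pl_continuous[OF int_pl_clip[OF assms]]
    unfolding mcnaughton_def by blast
qed

section \<open>McNaughton's theorem\<close>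

text \<open>The graph of \<open>d\<close> returns to \<open>0\<close> at \<open>t\<close> from below, along one of the finitely many affine
  pieces; that piece cannot decrease.\<close>
lemma rising_piece:
  fixes d :: "real \<Rightarrow> real" and F :: "(real \<Rightarrow> real) set"
  assumes F: "finite F" "\<And>p. p \<in> F \<Longrightarrow> \<exists>a b. p = (\<lambda>s. a + b * s)"
    and d: "continuous_on {0..1} d" "\<And>s. s \<in> {0..1} \<Longrightarrow> \<exists>p\<in>F. d s = p s"
    and t: "0 \<le> r" "r < t" "t \<le> 1" "d t = 0" "\<And>s. r < s \<Longrightarrow> s < t \<Longrightarrow> d s \<le> 0"
  shows "\<exists>p\<in>F. p 0 \<le> 0 \<and> 0 \<le> p 1"
proof -
  let ?L = "at t within {r<..<t}"
  have ntriv: "?L \<noteq> bot"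
    using t(2) by (simp add: trivial_limit_within islimpt_greaterThanLessThan2)
  \<comment> \<open>There are finitely many pieces, so one of them agrees with \<open>d\<close> at
    points arbitrarily close to \<open>t\<close> from the left.\<close>
  have "\<exists>p\<in>F. \<exists>\<^sub>F s in ?L. d s = p s \<and> s \<in> {r<..<t}"
  proof (rule ccontr)
    assume "\<not> ?thesis"
    then have "\<forall>\<^sub>F s in ?L. \<forall>p\<in>F. \<not> (d s = p s \<and> s \<in> {r<..<t})"
      unfolding frequently_def not_not bex_simps(8) by (intro eventually_ball_finite F(1))
    moreover have "\<forall>\<^sub>F s in ?L. s \<in> {r<..<t}" by (simp add: eventually_at_filter)
    ultimately have "\<forall>\<^sub>F s in ?L. False"
      by eventually_elim (use d(2) t in force)
    then show False using ntriv by simp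
  qed
  then obtain p where p: "p \<in> F" "\<exists>\<^sub>F s in ?L. d s = p s \<and> s \<in> {r<..<t}" by blast
  obtain a b where ab: "p = (\<lambda>s. a + b * s)" using F(2)[OF p(1)] by blast
  have "p t = 0"
  proof (rule ccontr)
    assume "p t \<noteq> 0"
    have "(d \<longlongrightarrow> d t) (at t within {0..1})"
      using d(1) t(1-3) unfolding continuous_on_def by auto
    then have "(d \<longlongrightarrow> d t) ?L"
      by (rule tendsto_within_subset) (use t in auto)
    moreover have "(p \<longlongrightarrow> p t) ?L" unfolding ab by (intro tendsto_intros)
    ultimately have "((\<lambda>s. d s - p s) \<longlongrightarrow> d t - p t) ?L" by (rule tendsto_diff)
    then have "\<forall>\<^sub>F s in ?L. d s - p s \<noteq> 0"
      by (rule tendsto_imp_eventually_ne) (use \<open>p t \<noteq> 0\<close> t in simp)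
    then have "\<forall>\<^sub>F s in ?L. \<not> (d s = p s \<and> s \<in> {r<..<t})" by (rule eventually_mono) auto
    then show False using p(2) unfolding frequently_def by blast
  qed
  obtain s where s: "d s = p s" "r < s" "s < t" using frequently_ex[OF p(2)] by auto
  have "a + b * s \<le> 0" using t(5)[of s] s by (simp add: ab)
  then have "b * (t - s) \<ge> 0" using \<open>p t = 0\<close> by (simp add: ab algebra_simps)
  then have "b \<ge> 0" using s by (simp add: zero_le_mult_iff)
  then have "b * t \<ge> 0" "b * (1 - t) \<ge> 0" using t by auto
  then have "p 0 \<le> 0" "0 \<le> p 1" using \<open>p t = 0\<close> by (auto simp: ab algebra_simps)
  then show ?thesis using p(1) by blast
qed

text \<open>If \<open>d\<close> is never positive, \<open>rising_piece\<close> applies to the whole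
  interval. Otherwise, before a positive point \<open>r\<close>, there is a last zero
  \<open>t\<close>, and reversing both time and sign makes the graph return to \<open>0\<close> from
  below at \<open>1 - t\<close>.\<close>

lemma nondecreasing_piece:
  fixes d :: "real \<Rightarrow> real" and F :: "(real \<Rightarrow> real) set"
  assumes F: "finite F" "\<And>p. p \<in> F \<Longrightarrow> \<exists>a b. p = (\<lambda>s. a + b * s)"
    and d: "continuous_on {0..1} d" "\<And>s. s \<in> {0..1} \<Longrightarrow> \<exists>p\<in>F. d s = p s"
    and d0: "d 0 = 0" "d 1 = 0"
  shows "\<exists>p\<in>F. p 0 \<le> 0 \<and> 0 \<le> p 1"
proof (cases "\<exists>r\<in>{0..1}. 0 < d r")
  case False
  then show ?thesis
    using d0 by (intro rising_piece[OF F d, of 0 1]) (auto simp: not_less)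
next
  case True
  then obtain r where r: "r \<in> {0..1}" "0 < d r" by blast
  define t where "t = Sup {s \<in> {0..r}. d s \<le> 0}"
  have cl: "compact {s \<in> {0..r}. d s \<le> 0}"
  proof -
    have "continuous_on {0..r} d" by (rule continuous_on_subset[OF d(1)]) (use r in auto)
    then have "closed {s \<in> {0..r}. d s \<le> 0}"
      using continuous_closed_preimage[of "{0..r}" d "{..0}"] by (simp add: vimage_def Int_def)
    then have "compact ({0..r} \<inter> {s \<in> {0..r}. d s \<le> 0})" by (intro compact_Int_closed) auto
    moreover have "{0..r} \<inter> {s \<in> {0..r}. d s \<le> 0} = {s \<in> {0..r}. d s \<le> 0}" by auto
    ultimately show ?thesis by simp
  qed
  have ne: "{s \<in> {0..r}. d s \<le> 0} \<noteq> {}" using r d0 by auto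
  have tin: "t \<in> {s \<in> {0..r}. d s \<le> 0}" unfolding t_def
    by (rule closed_contains_Sup[OF ne]) (use cl compact_imp_bounded compact_imp_closed bounded_imp_bdd_above in auto)
  have after: "0 < d s" if "t < s" "s \<le> r" for s
  proof (rule ccontr)
    assume "\<not> ?thesis"
    then have "s \<le> t" unfolding t_def using that tin
      by (intro cSup_upper) (use cl compact_imp_bounded bounded_imp_bdd_above in auto)
    then show False using that by simp
  qed
  have tr: "t < r" using tin r by (metis (mono_tags) atLeastAtMost_iff linorder_not_less mem_Collect_eq order_less_le)
  have dt: "d t = 0"
  proof (rule antisym)
    have "((\<lambda>s. d s) \<longlongrightarrow> d t) (at t within {t<..<r})"
      using d(1) tin r by (auto simp: continuous_on_def intro: tendsto_within_subset[of _ _ _ "{0..1}"])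
    moreover have "\<forall>\<^sub>F s in at t within {t<..<r}. 0 \<le> d s"
      using after by (force simp: eventually_at_filter intro: always_eventually)
    moreover have "at t within {t<..<r} \<noteq> bot"
      using tr by (simp add: trivial_limit_within islimpt_greaterThanLessThan1)
    ultimately show "0 \<le> d t" by (rule tendsto_lowerbound)
  qed (use tin in auto)
  \<comment> \<open>The reversal \<open>- p (1 - s)\<close> exchanges the two ends and changes the
    signs, so the condition \<open>q 0 \<le> 0 \<le> q 1\<close> is the same condition on
    \<open>p\<close>.\<close>
  define H where "H = (\<lambda>p s. - p (1 - s)) ` F"
  have "\<exists>q\<in>H. q 0 \<le> (0::real) \<and> 0 \<le> q (1::real)"
  proof (rule rising_piece[where d = "\<lambda>s. - d (1 - s)" and r = "1 - r" and t = "1 - t"])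
    show "finite H" using F(1) by (simp add: H_def)
    show "\<exists>a b. q = (\<lambda>s. a + b * s)" if qH: "q \<in> H" for q
    proof -
      obtain p where p: "p \<in> F" "q = (\<lambda>s. - p (1 - s))" using qH by (auto simp: H_def)
      obtain a b where "p = (\<lambda>s. a + b * s)" using F(2)[OF p(1)] by blast
      then have "q = (\<lambda>s. (- a - b) + b * s)" using p(2) by (auto simp: algebra_simps)
      then show ?thesis by blast
    qed
    show "continuous_on {0..1} (\<lambda>s. - d (1 - s))"
      by (intro continuous_on_minus continuous_on_compose2[OF d(1)] continuous_intros) auto
    show "\<exists>p\<in>H. - d (1 - s) = p s" if "s \<in> {0..1}" for s
    proof -
      have "1 - s \<in> {0..1}" using that by simp
      then obtain p where "p \<in> F" "d (1 - s) = p (1 - s)" using d(2) by blast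
      then show ?thesis by (auto simp: H_def)
    qed
    show "- d (1 - s) \<le> 0" if "1 - r < s" "s < 1 - t" for s
      using after[of "1 - s"] that by simp
  qed (use tr tin r dt in auto)
  then show ?thesis by (auto simp: H_def)
qed

text \<open>Restrict \<open>f\<close> to the segment from \<open>x\<close> to \<open>y\<close> and
  subtract the chord through its end values. The difference vanishes at both ends, and its pieces
  are those of \<open>f\<close> minus the chord.\<close>

lemma mcnaughton_piece_between:
  assumes "mcnaughton f" and F: "finite F" "\<And>p. p \<in> F \<Longrightarrow> integer_affine p"
    "\<And>x. x \<in> unit_cube \<Longrightarrow> \<exists>p\<in>F. f x = p x"
    and xy: "x \<in> unit_cube" "y \<in> unit_cube"
  shows "\<exists>p\<in>F. p x \<le> f x \<and> f y \<le> p y"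
proof -
  define z where "z s = x + s *\<^sub>R (y - x)" for s
  define e where "e s = f x + s * (f y - f x)" for s
  define H where "H = (\<lambda>p s. p (z s) - e s) ` F"
  have z: "z s \<in> unit_cube" if "s \<in> {0..1}" for s
  proof -
    have "z s = (1 - s) *\<^sub>R x + s *\<^sub>R y" by (simp add: z_def algebra_simps)
    then show ?thesis using convexD_alt[OF convex_box(1) xy] that by auto
  qed
  have "\<exists>q\<in>H. q 0 \<le> 0 \<and> 0 \<le> q 1"
  proof (rule nondecreasing_piece[where d = "\<lambda>s. f (z s) - e s"])
    show "finite H" using F(1) by (simp add: H_def)
    show "\<exists>a b. q = (\<lambda>s. a + b * s)" if qH: "q \<in> H" for q
    proof -
      obtain p where p: "p \<in> F" "q = (\<lambda>s. p (z s) - e s)" using qH by (auto simp: H_def)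
      obtain a b where "\<And>x. p x = a \<bullet> x + b" using integer_affine_inner F(2)[OF p(1)] by blast
      then have "q = (\<lambda>s. (a \<bullet> x + b - f x) + (a \<bullet> (y - x) - (f y - f x)) * s)"
        using p(2) by (auto simp: z_def e_def inner_add_right algebra_simps)
      then show ?thesis by blast
    qed
    show "continuous_on {0..1} (\<lambda>s. f (z s) - e s)"
    proof (intro continuous_on_diff)
      show "continuous_on {0..1} (\<lambda>s. f (z s))"
        by (rule continuous_on_compose2[of unit_cube])
          (use assms(1) z in \<open>auto simp: mcnaughton_def z_def intro!: continuous_intros\<close>)
      show "continuous_on {0..1} e" unfolding e_def by (intro continuous_intros)
    qed
    show "\<exists>q\<in>H. f (z s) - e s = q s" if "s \<in> {0..1}" for s
      using F(3)[OF z[OF that]] by (auto simp: H_def)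
  qed (simp_all add: z_def e_def)
  then show ?thesis by (auto simp: H_def z_def e_def)
qed

text \<open>McNaughton's theorem in max-min form: \<open>f z\<close> is the maximum over \<open>y\<close> of the minimum of those
  pieces \<open>p\<close> with \<open>f y \<le> p y\<close>, and only finitely many sets of pieces occur.\<close>
lemma mcnaughton_imp_int_pl:
  assumes "mcnaughton f"
  obtains \<phi> where "int_pl \<phi>" "\<And>x. x \<in> unit_cube \<Longrightarrow> f x = \<phi> x"
proof -
  obtain F where F: "finite F" "\<And>p. p \<in> F \<Longrightarrow> integer_affine p"
    "\<And>x. x \<in> unit_cube \<Longrightarrow> \<exists>p\<in>F. f x = p x"
    using assms unfolding mcnaughton_def by blast
  define K where "K y = {p \<in> F. f y \<le> p y}" for y
  define I where "I = K ` unit_cube"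
  have I: "finite I" using F(1) finite_subset[of I "Pow F"] by (auto simp: I_def K_def)
  have "0 \<in> unit_cube" by (simp add: mem_box_cart)
  then have I0: "I \<noteq> {}" by (auto simp: I_def)
  have finK: "finite J" if "J \<in> I" for J using that F(1) by (auto simp: I_def K_def)
  have neK: "J \<noteq> {}" if "J \<in> I" for J using that F(3) by (fastforce simp: I_def K_def)
  define \<phi> where "\<phi> = (\<lambda>x. MAX J\<in>I. MIN p\<in>J. p x)"
  have "int_pl \<phi>" unfolding \<phi>_def
    by (intro int_pl_Max int_pl_Min I I0 finK neK int_pl.affine F(2)) (auto simp: I_def K_def)
  moreover have "f x = \<phi> x" if x: "x \<in> unit_cube" for x
  proof (rule antisym)
    have "f x \<le> (MIN p\<in>K x. p x)"
      using finK[of "K x"] neK[of "K x"] x by (auto simp: I_def K_def)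
    also have "\<dots> \<le> \<phi> x" unfolding \<phi>_def using I x by (intro Max_ge) (auto simp: I_def)
    finally show "f x \<le> \<phi> x" .
    have "(MIN p\<in>J. p x) \<le> f x" if J: "J \<in> I" for J
    proof -
      obtain y where y: "y \<in> unit_cube" "J = K y" using J by (auto simp: I_def)
      obtain p where p: "p \<in> F" "p x \<le> f x" "f y \<le> p y"
        using mcnaughton_piece_between[OF assms F x y(1)] by blast
      then have "(MIN p\<in>J. p x) \<le> p x" using y finK[OF J] by (intro Min_le) (auto simp: K_def)
      then show ?thesis using p(2) by simp
    qed
    then show "\<phi> x \<le> f x" unfolding \<phi>_def using I I0 by (subst Max_le_iff) auto
  qed
  ultimately show ?thesis using that by blast
qed

section \<open>Rational polytopes\<close>

lemma rational_common_denominator: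
  assumes "finite R" "R \<subseteq> \<rat>"
  obtains D :: int where "D > 0" "\<And>r. r \<in> R \<Longrightarrow> of_int D * (r::real) \<in> \<int>"
proof -
  have "\<exists>D::int. D > 0 \<and> (\<forall>r\<in>R. of_int D * r \<in> \<int>)"
    using assms
  proof (induction R rule: finite_induct)
    case empty
    then show ?case by (intro exI[of _ 1]) auto
  next
    case (insert r R)
    then obtain D :: int where D: "D > 0" "\<forall>r\<in>R. of_int D * r \<in> \<int>" by auto
    obtain a b :: int where ab: "b > 0" "r = of_int a / of_int b"
      using insert.prems by (auto elim: Rats_cases')
    have "of_int (D * b) * s \<in> \<int>" if "s \<in> insert r R" for s
    proof (cases "s = r")
      case True
      then have "of_int (D * b) * s = of_int (D * a)" using ab by simp
      then show ?thesis by (metis Ints_of_int)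
    next
      case False
      then have "of_int b * (of_int D * s) \<in> \<int>" using False D(2) that by (intro Ints_mult[of "of_int b"]) auto
      then show ?thesis by (simp add: mult_ac)
    qed
    then show ?case using D(1) ab(1) by (intro exI[of _ "D * b"]) auto
  qed
  then show ?thesis using that by blast
qed

lemma between_finite_sets:
  fixes S T :: "real set"
  assumes "finite S" "finite T" "\<And>a b. a \<in> S \<Longrightarrow> b \<in> T \<Longrightarrow> a \<le> b"
  obtains s where "\<And>a. a \<in> S \<Longrightarrow> a \<le> s" "\<And>b. b \<in> T \<Longrightarrow> s \<le> b"
proof (cases "S = {}")
  case True
  show ?thesis
    by (rule that[of "if T = {} then 0 else Min T"]) (use True assms(2) in auto)
next
  case False
  show ?thesis
    by (rule that[of "Max S"]) (use False assms in auto)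
qed

text \<open>Eliminating one variable replaces each pair of a lower and an upper bound for it by the
  inequality between the two. The multipliers are integers, so integer coefficients persist through
  the induction.\<close>

lemma fourier_motzkin:
  fixes I :: "((real^'n \<Rightarrow> real) \<times> ('b \<Rightarrow> int)) set"
  assumes "finite B" "finite I" "\<And>l c. (l, c) \<in> I \<Longrightarrow> integer_affine l"
  shows "\<exists>L. finite L \<and> (\<forall>l\<in>L. integer_affine l) \<and>
    (\<forall>x. (\<exists>t. \<forall>(l, c)\<in>I. 0 \<le> l x + (\<Sum>b\<in>B. of_int (c b) * t b)) \<longleftrightarrow> (\<forall>l\<in>L. 0 \<le> l x))"
  using assms
proof (induction B arbitrary: I rule: finite_induct)
  case empty
  then show ?case by (intro exI[of _ "fst ` I"]) auto
next
  case (insert b B)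
  \<comment> \<open>For \<open>c1 b > 0 > c2 b\<close> both multipliers \<open>- c2 b\<close> and
    \<open>c1 b\<close> are positive, and the coefficient of \<open>t b\<close> cancels.\<close>
  define comb :: "((real^'n \<Rightarrow> real) \<times> ('b \<Rightarrow> int)) \<times> ((real^'n \<Rightarrow> real) \<times> ('b \<Rightarrow> int)) \<Rightarrow> _" where
    "comb = (\<lambda>((l1, c1), (l2, c2)). (\<lambda>x. of_int (- c2 b) * l1 x + of_int (c1 b) * l2 x,
        \<lambda>a. (- c2 b) * c1 a + c1 b * c2 a))"
  define Ip where "Ip = {(l, c) \<in> I. c b > 0}"
  define In where "In = {(l, c) \<in> I. c b < 0}"
  define J where "J = {(l, c) \<in> I. c b = 0} \<union> comb ` (Ip \<times> In)"
  have fin: "finite Ip" "finite In"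
    using insert.prems(1) by (auto simp: Ip_def In_def intro: rev_finite_subset)
  have "finite J" using fin insert.prems(1) by (auto simp: J_def intro: rev_finite_subset)
  moreover have "integer_affine l" if "(l, c) \<in> J" for l c
    using that insert.prems(2)
    by (auto simp: J_def comb_def Ip_def In_def
        intro!: integer_affine_diff integer_affine_cmult)
  ultimately obtain L where L: "finite L" "\<forall>l\<in>L. integer_affine l"
    "\<And>x. (\<exists>t. \<forall>(l, c)\<in>J. 0 \<le> l x + (\<Sum>b\<in>B. of_int (c b) * t b)) \<longleftrightarrow> (\<forall>l\<in>L. 0 \<le> l x)"
    using insert.IH[of J] by blast
  have "(\<exists>t. \<forall>(l, c)\<in>I. 0 \<le> l x + (\<Sum>b\<in>insert b B. of_int (c b) * t b)) \<longleftrightarrow>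
      (\<exists>t. \<forall>(l, c)\<in>J. 0 \<le> l x + (\<Sum>b\<in>B. of_int (c b) * t b))" for x
  proof -
    define e where "e t l c = l x + (\<Sum>b\<in>B. of_int (c b) * t b)" for t and l :: "real^'n \<Rightarrow> real" and c :: "'b \<Rightarrow> int"
    have e_comb: "e t (\<lambda>x. of_int (- c2 b) * l1 x + of_int (c1 b) * l2 x)
        (\<lambda>a. (- c2 b) * c1 a + c1 b * c2 a) =
        of_int (- c2 b) * e t l1 c1 + of_int (c1 b) * e t l2 c2" for t l1 l2 and c1 c2 :: "'b \<Rightarrow> int"
      by (simp add: e_def algebra_simps sum.distrib sum_distrib_left sum_subtractf sum_negf)
    have split: "l x + (\<Sum>b\<in>insert b B. of_int (c b) * t b) = e t l c + of_int (c b) * t b" for t l c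
      using insert.hyps by (simp add: e_def)
    show ?thesis
    proof
      assume "\<exists>t. \<forall>(l, c)\<in>I. 0 \<le> l x + (\<Sum>b\<in>insert b B. of_int (c b) * t b)"
      then obtain t where t: "\<And>l c. (l, c) \<in> I \<Longrightarrow> 0 \<le> e t l c + of_int (c b) * t b"
        unfolding split by blast
      have "0 \<le> e t l c" if "(l, c) \<in> J" for l c
      proof (cases "(l, c) \<in> I \<and> c b = 0")
        case True
        then show ?thesis using t[of l c] by simp
      next
        case False
        then obtain l1 c1 l2 c2 where lc: "(l1, c1) \<in> I" "c1 b > 0" "(l2, c2) \<in> I" "c2 b < 0"
          "l = (\<lambda>x. of_int (- c2 b) * l1 x + of_int (c1 b) * l2 x)"
          "c = (\<lambda>a. (- c2 b) * c1 a + c1 b * c2 a)"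
          using \<open>(l, c) \<in> J\<close> by (auto simp: J_def comb_def Ip_def In_def)
        have "0 \<le> of_int (- c2 b) * (e t l1 c1 + of_int (c1 b) * t b)"
          "0 \<le> of_int (c1 b) * (e t l2 c2 + of_int (c2 b) * t b)"
          using t[OF lc(1)] t[OF lc(3)] lc(2,4) by (auto intro!: mult_nonneg_nonneg mult_nonpos_nonneg)
        then show ?thesis unfolding lc(5,6) e_comb by (simp add: algebra_simps)
      qed
      then show "\<exists>t. \<forall>(l, c)\<in>J. 0 \<le> l x + (\<Sum>b\<in>B. of_int (c b) * t b)"
        unfolding e_def by blast
    next
      assume "\<exists>t. \<forall>(l, c)\<in>J. 0 \<le> l x + (\<Sum>b\<in>B. of_int (c b) * t b)"
      then obtain t where t: "\<And>l c. (l, c) \<in> J \<Longrightarrow> 0 \<le> e t l c" unfolding e_def by blast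
      \<comment> \<open>The members of \<open>Ip\<close> bound \<open>t b\<close> from below and
        those of \<open>In\<close> from above; the combined inequalities say that every lower bound
        is at most every upper bound.\<close>
      have le: "a1 \<le> a2" if a: "a1 \<in> (\<lambda>(l, c). - e t l c / of_int (c b)) ` Ip"
          "a2 \<in> (\<lambda>(l, c). - e t l c / of_int (c b)) ` In" for a1 a2
      proof -
        obtain l1 c1 l2 c2 where lc: "(l1, c1) \<in> Ip" "(l2, c2) \<in> In"
          "a1 = - e t l1 c1 / of_int (c1 b)" "a2 = - e t l2 c2 / of_int (c2 b)" using a by auto
        then have pos: "c1 b > 0" "c2 b < 0" by (auto simp: Ip_def In_def)
        have "comb ((l1, c1), (l2, c2)) \<in> J" using lc by (auto simp: J_def)
        then have "0 \<le> of_int (- c2 b) * e t l1 c1 + of_int (c1 b) * e t l2 c2"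
          unfolding comb_def prod.case by (drule_tac t) (simp only: e_comb)
        then have "of_int (c2 b) * e t l1 c1 / (of_int (c1 b) * of_int (c2 b)) \<ge>
            of_int (c1 b) * e t l2 c2 / (of_int (c1 b) * of_int (c2 b))"
          using pos by (intro divide_right_mono_neg) (auto simp: mult_nonneg_nonpos)
        then show ?thesis using pos lc by simp
      qed
      have fin': "finite ((\<lambda>(l, c). - e t l c / of_int (c b)) ` Ip)"
          "finite ((\<lambda>(l, c). - e t l c / of_int (c b)) ` In)" using fin by auto
      obtain s where s: "\<And>a. a \<in> (\<lambda>(l, c). - e t l c / of_int (c b)) ` Ip \<Longrightarrow> a \<le> s"
        "\<And>a. a \<in> (\<lambda>(l, c). - e t l c / of_int (c b)) ` In \<Longrightarrow> s \<le> a"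
        using between_finite_sets[OF fin' le] by blast
      have "0 \<le> e (t(b := s)) l c + of_int (c b) * s" if "(l, c) \<in> I" for l c
      proof -
        have eq: "e (t(b := s)) l c = e t l c"
          unfolding e_def using insert.hyps by (auto intro!: sum.cong)
        consider "c b = 0" | "c b > 0" | "c b < 0" by linarith
        then show ?thesis
        proof cases
          case 1
          then show ?thesis using t[of l c] that by (simp add: eq J_def)
        next
          case 2
          then have "- e t l c / of_int (c b) \<le> s" using that by (intro s) (force simp: Ip_def)
          then show ?thesis using 2 by (simp add: eq field_simps)
        next
          case 3
          then have "s \<le> - e t l c / of_int (c b)" using that by (intro s) (force simp: In_def)
          then show ?thesis using 3 by (simp add: eq field_simps)
        qed
      qed
      then have "\<forall>(l, c)\<in>I. 0 \<le> l x + (\<Sum>a\<in>insert b B. of_int (c a) * (t(b := s)) a)"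
        unfolding split by auto
      then show "\<exists>t. \<forall>(l, c)\<in>I. 0 \<le> l x + (\<Sum>b\<in>insert b B. of_int (c b) * t b)" by blast
    qed
  qed
  then show ?case using L by (intro exI[of _ L]) auto
qed

text \<open>The hull is the projection to \<open>x\<close> of the system stating that
  \<open>t\<close> is a family of convex weights with barycentre \<open>x\<close>. After clearing
  denominators this system has integer coefficients, and elimination of \<open>t\<close>
  applies.\<close>

lemma rational_hull_halfspaces:
  fixes V :: "(real^'n) set"
  assumes "finite V" "\<And>v i. v \<in> V \<Longrightarrow> v $ i \<in> \<rat>"
  obtains L where "finite L" "\<And>l. l \<in> L \<Longrightarrow> integer_affine l"
    "convex hull V = {x. \<forall>l\<in>L. 0 \<le> l x}"
proof -
  have "finite (\<Union>v\<in>V. range (($) v))" "(\<Union>v\<in>V. range (($) v)) \<subseteq> \<rat>"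
    using assms by auto
  then obtain D :: int where D: "D > 0"
    "\<And>r. r \<in> (\<Union>v\<in>V. range (($) v)) \<Longrightarrow> of_int D * (r::real) \<in> \<int>"
    using rational_common_denominator by blast
  define N where "N i v = \<lfloor>of_int D * v $ i\<rfloor>" for i and v :: "real^'n"
  have N: "of_int (N i v) = of_int D * v $ i" if "v \<in> V" for i v
  proof -
    have "of_int D * v $ i \<in> \<int>" by (rule D(2)) (use that in auto)
    then show ?thesis by (auto simp: N_def elim!: Ints_cases)
  qed
  \<comment> \<open>Each equation is written as two inequalities: the first two families express the
    barycentre, the third the signs of the weights, and the last pair their sum.\<close>
  define I :: "((real^'n \<Rightarrow> real) \<times> ((real^'n) \<Rightarrow> int)) set" where
    "I = (\<lambda>i. (\<lambda>x. of_int D * x $ i, \<lambda>v. - N i v)) ` UNIV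
       \<union> (\<lambda>i. (\<lambda>x. of_int (- D) * x $ i, \<lambda>v. N i v)) ` UNIV
       \<union> (\<lambda>w. (\<lambda>x. of_int 0, \<lambda>v. of_bool (v = w))) ` V
       \<union> {(\<lambda>x. of_int (- 1), \<lambda>v. 1), (\<lambda>x. of_int 1, \<lambda>v. - 1)}"
  have "finite I" using assms(1) by (simp add: I_def)
  moreover have "integer_affine l" if "(l, c) \<in> I" for l c
    using that unfolding I_def
    by (elim UnE imageE insertE emptyE; simp only: prod.inject)
      (auto intro: integer_affine_cmult integer_affine_coord integer_affine_const simp del: of_int_minus of_int_0 of_int_1)
  ultimately obtain L where L: "finite L" "\<forall>l\<in>L. integer_affine l"
    "\<And>x. (\<exists>t. \<forall>(l, c)\<in>I. 0 \<le> l x + (\<Sum>b\<in>V. of_int (c b) * t b)) \<longleftrightarrow> (\<forall>l\<in>L. 0 \<le> l x)"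
    using fourier_motzkin[OF assms(1), of I] by blast
  have "(\<forall>(l, c)\<in>I. 0 \<le> l x + (\<Sum>b\<in>V. of_int (c b) * t b)) \<longleftrightarrow>
      (\<forall>v\<in>V. 0 \<le> t v) \<and> sum t V = 1 \<and> (\<Sum>v\<in>V. t v *\<^sub>R v) = x" for x t
  proof -
    have ind: "(\<Sum>b\<in>V. of_bool (b = w) * t b) = t w" if "w \<in> V" for w
      using that assms(1) by (simp add: of_bool_def if_distrib[of "\<lambda>a. a * _"] cong: if_cong)
    have co: "(\<Sum>v\<in>V. of_int (N i v) * t v) = of_int D * (\<Sum>v\<in>V. t v *\<^sub>R v) $ i" for i
      by (auto simp: N sum_distrib_left intro!: sum.cong)
    have "(\<forall>(l, c)\<in>I. 0 \<le> l x + (\<Sum>b\<in>V. of_int (c b) * t b)) \<longleftrightarrow>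
       (\<forall>i. 0 \<le> of_int D * x $ i - of_int D * (\<Sum>v\<in>V. t v *\<^sub>R v) $ i) \<and>
       (\<forall>i. 0 \<le> of_int D * (\<Sum>v\<in>V. t v *\<^sub>R v) $ i - of_int D * x $ i) \<and>
       (\<forall>w\<in>V. 0 \<le> t w) \<and> 0 \<le> sum t V - 1 \<and> 0 \<le> 1 - sum t V"
      unfolding I_def co[symmetric] by (auto simp: ball_Un sum_negf ind simp del: sum_component)
    also have "\<dots> \<longleftrightarrow> (\<forall>v\<in>V. 0 \<le> t v) \<and> sum t V = 1 \<and> (\<Sum>v\<in>V. t v *\<^sub>R v) = x"
      using D(1) by (auto simp: vec_eq_iff antisym simp del: sum_component)
    finally show ?thesis .
  qed
  then have "convex hull V = {x. \<forall>l\<in>L. 0 \<le> l x}"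
    unfolding convex_hull_finite[OF assms(1)] L(3)[symmetric] by simp
  then show ?thesis using that L by blast
qed

text \<open>The factors \<open>\<mu> w * - l w / \<beta>\<close> sum to \<open>1\<close> over
  \<open>V2\<close>, so the positive side is recovered in full, while the negative side enters with
  the fraction \<open>\<alpha> / \<beta>\<close>. The identity is used for \<open>h\<close> the
  identity, to locate a point, and for \<open>h\<close> constant, to add up weights.\<close>

lemma zero_crossing_sum:
  fixes h :: "'a \<Rightarrow> 'b::real_vector"
  assumes \<beta>: "\<beta> = (\<Sum>w\<in>V2. \<mu> w * - l w)" "\<beta> \<noteq> 0"
    and \<alpha>: "\<alpha> = (\<Sum>v\<in>V1. \<mu> v * l v)"
  shows "(\<Sum>(v, w)\<in>V1 \<times> V2. (\<mu> v * \<mu> w / \<beta>) *\<^sub>R ((- l w) *\<^sub>R h v + l v *\<^sub>R h w)) =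
    (\<Sum>v\<in>V1. \<mu> v *\<^sub>R h v) + (\<alpha> / \<beta>) *\<^sub>R (\<Sum>w\<in>V2. \<mu> w *\<^sub>R h w)"
proof -
  have "(\<Sum>(v, w)\<in>V1 \<times> V2. (\<mu> v * \<mu> w / \<beta>) *\<^sub>R ((- l w) *\<^sub>R h v + l v *\<^sub>R h w)) =
      (\<Sum>v\<in>V1. \<Sum>w\<in>V2. (\<mu> w * - l w / \<beta>) *\<^sub>R (\<mu> v *\<^sub>R h v))
    + (\<Sum>v\<in>V1. \<Sum>w\<in>V2. (\<mu> v * l v / \<beta>) *\<^sub>R (\<mu> w *\<^sub>R h w))"
    by (simp add: sum.cartesian_product[symmetric] sum.distrib[symmetric] algebra_simps
        scaleR_add_right)
  also have "(\<Sum>v\<in>V1. \<Sum>w\<in>V2. (\<mu> w * - l w / \<beta>) *\<^sub>R (\<mu> v *\<^sub>R h v)) =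
      (\<Sum>v\<in>V1. (\<beta> / \<beta>) *\<^sub>R (\<mu> v *\<^sub>R h v))"
    unfolding scaleR_left.sum[symmetric] sum_divide_distrib[symmetric] \<beta>(1)[symmetric] ..
  also have "(\<Sum>v\<in>V1. \<Sum>w\<in>V2. (\<mu> v * l v / \<beta>) *\<^sub>R (\<mu> w *\<^sub>R h w)) =
      (\<alpha> / \<beta>) *\<^sub>R (\<Sum>w\<in>V2. \<mu> w *\<^sub>R h w)"
    unfolding scaleR_right.sum[symmetric] scaleR_left.sum[symmetric] sum_divide_distrib[symmetric] \<alpha>[symmetric] ..
  finally show ?thesis using \<beta>(2) by simp
qed

text \<open>The new vertices are the points at which the segments between vertices on opposite sides meet
  the hyperplane.\<close>
lemma convex_hull_cut:
  fixes V :: "(real^'n) set"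
  assumes V: "finite V" "\<And>v i. v \<in> V \<Longrightarrow> v $ i \<in> \<rat>" and l: "integer_affine l"
  obtains W where "finite W" "\<And>v i. v \<in> W \<Longrightarrow> v $ i \<in> \<rat>"
    "convex hull W = convex hull V \<inter> {x. l x \<le> 0}"
proof -
  obtain a b where lab: "\<And>x. l x = a \<bullet> x + b" using integer_affine_inner l by blast
  define V1 where "V1 = {v \<in> V. 0 < l v}"
  define V2 where "V2 = {v \<in> V. l v < 0}"
  define V3 where "V3 = {v \<in> V. l v \<le> 0}"
  \<comment> \<open>The point where the segment from \<open>v\<close> to \<open>w\<close> meets the
    zero set of \<open>l\<close>.\<close>
  define z where "z = (\<lambda>(v, w). (1 / (l v - l w)) *\<^sub>R ((- l w) *\<^sub>R v + l v *\<^sub>R w))"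
  define W where "W = V3 \<union> z ` (V1 \<times> V2)"
  have fin: "finite V1" "finite V2" "finite V3" using V(1) by (auto simp: V1_def V2_def V3_def)
  have "finite W" using fin by (simp add: W_def)
  moreover have "w $ i \<in> \<rat>" if "w \<in> W" for w i
  proof -
    have lQ: "l v \<in> \<rat>" if "v \<in> V" for v using integer_affine_Rats[OF l] V(2) that by blast
    show ?thesis using that lQ V(2)
      by (auto simp: W_def V1_def V2_def V3_def z_def intro!: Rats_divide Rats_diff Rats_mult)
  qed
  moreover have "convex hull W = convex hull V \<inter> {x. l x \<le> 0}"
  proof
    have cH: "convex {x. l x \<le> 0}"
      using convex_halfspace_le[of a "- b"] by (simp add: lab le_diff_eq flip: diff_minus_eq_add)
    have "z (v, w) \<in> convex hull V \<inter> {x. l x \<le> 0}" if "v \<in> V1" "w \<in> V2" for v w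
    proof
      have pos: "0 < l v" "l w < 0" and inV: "v \<in> V" "w \<in> V" using that by (auto simp: V1_def V2_def)
      have "z (v, w) = (- l w / (l v - l w)) *\<^sub>R v + (l v / (l v - l w)) *\<^sub>R w"
        by (simp add: z_def scaleR_add_right scaleR_diff_right)
      also have "\<dots> \<in> convex hull V"
      proof (rule convexD[OF convex_convex_hull])
        show "- l w / (l v - l w) + l v / (l v - l w) = 1"
          using pos diff_divide_distrib[of "l v" "l w" "l v - l w"] by simp
      qed (use pos inV in \<open>auto intro!: hull_inc divide_nonneg_nonneg divide_nonpos_nonneg\<close>)
      finally show "z (v, w) \<in> convex hull V" .
      have "l (z (v, w)) = (1 / (l v - l w)) * ((- l w) * (l v - b) + l v * (l w - b)) + b"
        by (simp add: z_def lab inner_add_right inner_diff_right algebra_simps)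
      also have "\<dots> = (1 / (l v - l w)) * (- b * (l v - l w)) + b" by (simp add: algebra_simps)
      also have "\<dots> = 0" using pos by simp
      finally show "z (v, w) \<in> {x. l x \<le> 0}" by simp
    qed
    then have "W \<subseteq> convex hull V \<inter> {x. l x \<le> 0}"
      by (auto simp: W_def V3_def hull_inc)
    then show "convex hull W \<subseteq> convex hull V \<inter> {x. l x \<le> 0}"
      by (intro hull_minimal convex_Int convex_convex_hull cH)
  next
    show "convex hull V \<inter> {x. l x \<le> 0} \<subseteq> convex hull W"
    proof
      fix x assume "x \<in> convex hull V \<inter> {x. l x \<le> 0}"
      then obtain \<mu> where \<mu>: "\<And>v. v \<in> V \<Longrightarrow> 0 \<le> \<mu> v" "sum \<mu> V = 1"
        and x: "(\<Sum>v\<in>V. \<mu> v *\<^sub>R v) = x" and lx: "l x \<le> 0"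
        unfolding convex_hull_finite[OF V(1)] by auto
      \<comment> \<open>The contributions of the two sides to \<open>l x\<close>, which equals
        \<open>\<alpha> - \<beta>\<close>; hence \<open>\<alpha> \<le> \<beta>\<close>, and the
        negative side suffices to balance all of \<open>V1\<close>.\<close>
      define \<alpha> where "\<alpha> = (\<Sum>v\<in>V1. \<mu> v * l v)"
      define \<beta> where "\<beta> = (\<Sum>w\<in>V2. \<mu> w * - l w)"
      have V13: "V = V1 \<union> V3" "V1 \<inter> V3 = {}" by (auto simp: V1_def V3_def)
      have V32: "V2 \<subseteq> V3" by (auto simp: V2_def V3_def)
      have split: "sum k V = sum k V1 + sum k V3" for k :: "_ \<Rightarrow> 'c::comm_monoid_add"
        using V13 fin by (metis sum.union_disjoint)
      have "(\<Sum>v\<in>V3. \<mu> v * l v) = (\<Sum>v\<in>V2. \<mu> v * l v)"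
        using fin by (intro sum.mono_neutral_right) (auto simp: V2_def V3_def)
      then have "l x = \<alpha> - \<beta>"
        unfolding x[symmetric] integer_affine_combination[OF l V(1) \<mu>(2)]
        by (simp add: split \<alpha>_def \<beta>_def sum_negf)
      then have \<alpha>\<beta>: "\<alpha> \<le> \<beta>" using lx by simp
      have \<alpha>0: "0 \<le> \<alpha>" unfolding \<alpha>_def using \<mu>(1) by (intro sum_nonneg) (auto simp: V1_def)
      have inW: "w \<in> convex hull W" if "w \<in> V3" for w using that by (auto simp: W_def hull_inc)
      show "x \<in> convex hull W"
      proof (cases "\<alpha> = 0")
        case True
        have "\<mu> v = 0" if "v \<in> V1" for v
        proof -
          have "\<forall>v\<in>V1. \<mu> v * l v = 0"
            using True unfolding \<alpha>_def
            by (subst (asm) sum_nonneg_eq_0_iff) (use fin \<mu>(1) in \<open>auto simp: V1_def\<close>)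
          then show ?thesis using that by (auto simp: V1_def)
        qed
        then have "x = (\<Sum>v\<in>V3. \<mu> v *\<^sub>R v)" "sum \<mu> V3 = 1"
          using x \<mu>(2) by (auto simp: split)
        then show ?thesis
          using convex_sum[OF fin(3) convex_convex_hull, of \<mu> "\<lambda>v. v" W] inW \<mu>(1) by (auto simp: V3_def)
      next
        case False
        then have \<beta>0: "\<beta> > 0" using \<alpha>0 \<alpha>\<beta> by simp
        \<comment> \<open>The factor \<open>l v - l w\<close> undoes the normalisation of
          \<open>z\<close>.\<close>
        define c where "c = (\<lambda>(v, w). \<mu> v * \<mu> w / \<beta> * (l v - l w))"
        \<comment> \<open>The crossing points have used up the fraction
          \<open>\<alpha> / \<beta>\<close> of the weight on \<open>V2\<close>; this is the weight
          that remains on the old vertices.\<close>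
        define k where "k w = (if w \<in> V2 then \<mu> w * (1 - \<alpha> / \<beta>) else \<mu> w)" for w
        have ksum: "(\<Sum>w\<in>V3. k w *\<^sub>R h w) = (\<Sum>w\<in>V3. \<mu> w *\<^sub>R h w) - (\<alpha> / \<beta>) *\<^sub>R (\<Sum>w\<in>V2. \<mu> w *\<^sub>R h w)"
          for h :: "real^'n \<Rightarrow> 'c::real_vector"
        proof -
          have "(\<Sum>w\<in>V3. k w *\<^sub>R h w) =
              (\<Sum>w\<in>V3. \<mu> w *\<^sub>R h w - (if w \<in> V2 then (\<alpha> / \<beta>) *\<^sub>R \<mu> w *\<^sub>R h w else 0))"
            by (intro sum.cong refl) (simp add: k_def algebra_simps)
          also have "\<dots> = (\<Sum>w\<in>V3. \<mu> w *\<^sub>R h w) - (\<Sum>w\<in>V2. (\<alpha> / \<beta>) *\<^sub>R \<mu> w *\<^sub>R h w)"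
            using fin V32 by (simp add: sum_subtractf sum.If_cases Int_absorb1)
          finally show ?thesis by (simp add: scaleR_sum_right)
        qed
        have csum: "(\<Sum>vw\<in>V1 \<times> V2. c vw *\<^sub>R z vw) =
            (\<Sum>v\<in>V1. \<mu> v *\<^sub>R v) + (\<alpha> / \<beta>) *\<^sub>R (\<Sum>w\<in>V2. \<mu> w *\<^sub>R w)"
          unfolding zero_crossing_sum[OF \<beta>_def less_imp_neq[OF \<beta>0, symmetric] \<alpha>_def, symmetric]
          by (intro sum.cong refl) (force simp: c_def z_def V1_def V2_def)
        have csum1: "sum c (V1 \<times> V2) = sum \<mu> V1 + (\<alpha> / \<beta>) * sum \<mu> V2"
        proof -
          have "sum c (V1 \<times> V2) =
              (\<Sum>(v, w)\<in>V1 \<times> V2. (\<mu> v * \<mu> w / \<beta>) *\<^sub>R ((- l w) *\<^sub>R 1 + l v *\<^sub>R 1))"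
            by (intro sum.cong refl) (auto simp: c_def)
          then show ?thesis
            using zero_crossing_sum[OF \<beta>_def less_imp_neq[OF \<beta>0, symmetric] \<alpha>_def, of "\<lambda>_. 1::real"]
            by simp
        qed
        let ?c = "case_sum c k" and ?z = "case_sum z (\<lambda>w. w)"
        have "(\<Sum>i\<in>(V1 \<times> V2) <+> V3. ?c i *\<^sub>R ?z i) \<in> convex hull W"
        proof (rule convex_sum[OF _ convex_convex_hull])
          show "finite ((V1 \<times> V2) <+> V3)" using fin by simp
          show "sum ?c ((V1 \<times> V2) <+> V3) = 1"
            using fin \<mu>(2) csum1 ksum[of "\<lambda>_. 1::real"] by (simp add: sum.Plus split comp_def)
          fix i assume i: "i \<in> (V1 \<times> V2) <+> V3"
          have "0 \<le> 1 - \<alpha> / \<beta>" using \<alpha>\<beta> \<beta>0 by simp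
          then show "0 \<le> ?c i" using i \<mu>(1) \<beta>0
            by (auto simp: c_def k_def V1_def V2_def V3_def intro!: mult_nonneg_nonneg divide_nonneg_nonneg)
          show "?z i \<in> convex hull W" using i inW by (auto simp: W_def intro!: hull_inc)
        qed
        also have "(\<Sum>i\<in>(V1 \<times> V2) <+> V3. ?c i *\<^sub>R ?z i) = x"
          using fin csum ksum[of "\<lambda>w. w"] x by (simp add: sum.Plus split comp_def)
        finally show ?thesis .
      qed
    qed
  qed
  ultimately show ?thesis using that by blast
qed

section \<open>Covers by rational polytopes on which given functions are affine\<close>

definition rational_points :: "(real^'n) set \<Rightarrow> bool" where
  "rational_points V \<longleftrightarrow> finite V \<and> (\<forall>v\<in>V. \<forall>i. v $ i \<in> \<rat>)"

definition affine_on_hull :: "(real^'n \<Rightarrow> real) \<Rightarrow> (real^'n) set \<Rightarrow> bool" where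
  "affine_on_hull f V \<longleftrightarrow> (\<exists>p. integer_affine p \<and> (\<forall>x\<in>convex hull V. f x = p x))"

text \<open>A mere cover: pieces may overlap and need not be simplexes or meet along faces. This
  suffices because the final factorization is a minimum of functions, each tight on one
  piece.\<close>

definition refinement :: "(real^'n) set \<Rightarrow> (real^'n) set set \<Rightarrow> bool" where
  "refinement S \<W> \<longleftrightarrow> finite \<W> \<and> (\<forall>W\<in>\<W>. rational_points W) \<and> S = (\<Union>W\<in>\<W>. convex hull W)"

text \<open>Every new piece is recorded as lying inside an old one, so that properties inherited by
  smaller hulls, such as affineness of earlier functions, survive the refinement.\<close>

lemma refinement_refine:
  assumes "refinement S \<W>"
    and "\<And>W. rational_points W \<Longrightarrow> \<exists>\<X>. refinement (convex hull W) \<X> \<and> (\<forall>X\<in>\<X>. Q X)"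
  shows "\<exists>\<X>. refinement S \<X> \<and> (\<forall>X\<in>\<X>. Q X \<and> (\<exists>W\<in>\<W>. convex hull X \<subseteq> convex hull W))"
proof -
  have "\<forall>W\<in>\<W>. \<exists>\<X>. refinement (convex hull W) \<X> \<and> (\<forall>X\<in>\<X>. Q X)"
    using assms by (auto simp: refinement_def)
  then obtain R where R: "\<And>W. W \<in> \<W> \<Longrightarrow> refinement (convex hull W) (R W) \<and> (\<forall>X\<in>R W. Q X)"
    by metis
  have "refinement S (\<Union>W\<in>\<W>. R W)"
    using assms(1) R unfolding refinement_def by auto
  moreover have "convex hull X \<subseteq> convex hull W" if "W \<in> \<W>" "X \<in> R W" for W X
    using R[OF that(1)] that(2) by (auto simp: refinement_def)
  ultimately show ?thesis using R by (intro exI[of _ "\<Union>W\<in>\<W>. R W"]) blast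
qed

lemma affine_on_hull_mono:
  "affine_on_hull f W \<Longrightarrow> convex hull X \<subseteq> convex hull W \<Longrightarrow> affine_on_hull f X"
  unfolding affine_on_hull_def by blast

lemma refinement_self: "rational_points W \<Longrightarrow> refinement (convex hull W) {W}"
  by (simp add: refinement_def)

lemma refinement_halfspaces:
  assumes "rational_points W" "integer_affine l"
  shows "\<exists>\<X>. refinement (convex hull W) \<X> \<and>
    (\<forall>X\<in>\<X>. (\<forall>x\<in>convex hull X. l x \<le> 0) \<or> (\<forall>x\<in>convex hull X. 0 \<le> l x))"
proof -
  obtain X1 where X1: "finite X1" "\<And>v i. v \<in> X1 \<Longrightarrow> v $ i \<in> \<rat>"
    "convex hull X1 = convex hull W \<inter> {x. l x \<le> 0}"
    using convex_hull_cut[of W l] assms unfolding rational_points_def by blast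
  obtain X2 where X2: "finite X2" "\<And>v i. v \<in> X2 \<Longrightarrow> v $ i \<in> \<rat>"
    "convex hull X2 = convex hull W \<inter> {x. - l x \<le> 0}"
    using convex_hull_cut[OF _ _ integer_affine_uminus[OF assms(2)], of W] assms(1)
    unfolding rational_points_def by blast
  show ?thesis
    by (rule exI[of _ "{X1, X2}"]) (use X1 X2 in \<open>auto simp: refinement_def rational_points_def\<close>)
qed

text \<open>For a maximum or minimum of \<open>u\<close> and \<open>v\<close>, first refine until
  both are affine, say \<open>p\<close> and \<open>q\<close>, and then cut each piece along the zero
  set of \<open>p - q\<close>.\<close>

lemma refinement_int_pl:
  assumes "int_pl f" "rational_points W"
  shows "\<exists>\<X>. refinement (convex hull W) \<X> \<and> (\<forall>X\<in>\<X>. affine_on_hull f X)"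
proof -
  have step: "\<exists>\<X>. refinement (convex hull W) \<X> \<and> (\<forall>X\<in>\<X>. affine_on_hull k X)"
    if W: "rational_points W"
    and f: "\<And>W. rational_points W \<Longrightarrow> \<exists>\<X>. refinement (convex hull W) \<X> \<and> (\<forall>X\<in>\<X>. affine_on_hull u X)"
    and g: "\<And>W. rational_points W \<Longrightarrow> \<exists>\<X>. refinement (convex hull W) \<X> \<and> (\<forall>X\<in>\<X>. affine_on_hull v X)"
    and k: "(\<forall>x. k x = max (u x) (v x)) \<or> (\<forall>x. k x = min (u x) (v x))"
    for u v k and W :: "(real^'n) set"
  proof -
    have kaff: "\<exists>\<X>. refinement (convex hull W) \<X> \<and> (\<forall>X\<in>\<X>. affine_on_hull k X)"
      if W: "rational_points W" and fW: "affine_on_hull u W" and gW: "affine_on_hull v W" for W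
    proof -
      obtain p q where p: "integer_affine p" "\<And>x. x \<in> convex hull W \<Longrightarrow> u x = p x"
        and q: "integer_affine q" "\<And>x. x \<in> convex hull W \<Longrightarrow> v x = q x"
        using fW gW unfolding affine_on_hull_def by blast
      obtain \<X> where \<X>: "refinement (convex hull W) \<X>" "\<And>X. X \<in> \<X> \<Longrightarrow>
        (\<forall>x\<in>convex hull X. p x - q x \<le> 0) \<or> (\<forall>x\<in>convex hull X. 0 \<le> p x - q x)"
        using refinement_halfspaces[OF W integer_affine_diff[OF p(1) q(1)]] by blast
      have "affine_on_hull k X" if "X \<in> \<X>" for X
      proof -
        have "X \<in> \<X> \<Longrightarrow> convex hull X \<subseteq> convex hull W" using \<X>(1) by (auto simp: refinement_def)
        then have eq: "u x = p x \<and> v x = q x" if "x \<in> convex hull X" for x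
          using p(2) q(2) that \<open>X \<in> \<X>\<close> by blast
        have "(\<forall>x\<in>convex hull X. k x = p x) \<or> (\<forall>x\<in>convex hull X. k x = q x)"
        proof (cases "\<forall>x\<in>convex hull X. p x - q x \<le> 0")
          case True
          then have "\<forall>x\<in>convex hull X. max (u x) (v x) = q x \<and> min (u x) (v x) = p x"
            using eq by simp
          then show ?thesis using k by metis
        next
          case False
          then have "\<forall>x\<in>convex hull X. 0 \<le> p x - q x" using \<X>(2)[OF that] by blast
          then have "\<forall>x\<in>convex hull X. max (u x) (v x) = p x \<and> min (u x) (v x) = q x"
            using eq by simp
          then show ?thesis using k by metis
        qed
        then show ?thesis using p(1) q(1) unfolding affine_on_hull_def by blast
      qed
      then show ?thesis using \<X>(1) by blast
    qed
    obtain \<X>1 where \<X>1: "refinement (convex hull W) \<X>1" "\<forall>X\<in>\<X>1. affine_on_hull u X" using f[OF W] by blast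
    obtain \<X>2 where \<X>2: "refinement (convex hull W) \<X>2" "\<forall>X\<in>\<X>2. affine_on_hull v X \<and> affine_on_hull u X"
      using refinement_refine[OF \<X>1(1), of "affine_on_hull v"] g \<X>1(2) affine_on_hull_mono by metis
    have "\<forall>X\<in>\<X>2. \<exists>\<Y>. refinement (convex hull X) \<Y> \<and> (\<forall>Y\<in>\<Y>. affine_on_hull k Y)"
      using kaff \<X>2 by (auto simp: refinement_def)
    then obtain R where R: "\<And>X. X \<in> \<X>2 \<Longrightarrow> refinement (convex hull X) (R X) \<and> (\<forall>Y\<in>R X. affine_on_hull k Y)"
      by metis
    have "refinement (convex hull W) (\<Union>X\<in>\<X>2. R X)"
      using \<X>2(1) R unfolding refinement_def by auto
    then show ?thesis using R by blast
  qed
  show ?thesis using assms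
  proof (induction arbitrary: W rule: int_pl.induct)
    case (affine p)
    then show ?case using refinement_self[of W] by (auto simp: affine_on_hull_def)
  next
    case (max f g)
    show ?case by (rule step[OF max.prems max.IH]) auto
  next
    case (min f g)
    show ?case by (rule step[OF min.prems min.IH]) auto
  qed
qed

lemma refinement_int_pl_finite:
  assumes "finite \<Phi>" "\<And>f. f \<in> \<Phi> \<Longrightarrow> int_pl f" "refinement S \<W>"
  shows "\<exists>\<X>. refinement S \<X> \<and> (\<forall>X\<in>\<X>. \<forall>f\<in>\<Phi>. affine_on_hull f X)"
  using assms
proof (induction \<Phi> rule: finite_induct)
  case empty
  then show ?case by auto
next
  case (insert f \<Phi>)
  then obtain \<X> where \<X>: "refinement S \<X>" "\<forall>X\<in>\<X>. \<forall>f\<in>\<Phi>. affine_on_hull f X" by auto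
  obtain \<Y> where "refinement S \<Y>"
    "\<forall>Y\<in>\<Y>. affine_on_hull f Y \<and> (\<exists>X\<in>\<X>. convex hull Y \<subseteq> convex hull X)"
    using refinement_refine[OF \<X>(1), of "affine_on_hull f"] refinement_int_pl[of f] insert.prems by blast
  then show ?case using \<X>(2) affine_on_hull_mono by (metis insertE)
qed

section \<open>Integer solutions of linear systems\<close>

definition int_vec :: "real^'m \<Rightarrow> bool" where
  "int_vec y \<longleftrightarrow> (\<forall>i. y $ i \<in> \<int>)"

lemma int_vec_add: "int_vec x \<Longrightarrow> int_vec y \<Longrightarrow> int_vec (x + y)"
  and int_vec_diff: "int_vec x \<Longrightarrow> int_vec y \<Longrightarrow> int_vec (x - y)"
  and int_vec_scaleR: "c \<in> \<int> \<Longrightarrow> int_vec x \<Longrightarrow> int_vec (c *\<^sub>R x)"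
  by (auto simp: int_vec_def)

lemma int_vec_inner: "int_vec x \<Longrightarrow> int_vec y \<Longrightarrow> x \<bullet> y \<in> \<int>"
  by (auto simp: int_vec_def inner_vec_def intro!: Ints_sum Ints_mult)

text \<open>Subgroups of the integers are cyclic: division with remainder by the least positive
  element.\<close>

lemma subgroup_int_generator:
  fixes S :: "real set"
  assumes "S \<subseteq> \<int>" "0 \<in> S" and comb: "\<And>s t k. s \<in> S \<Longrightarrow> t \<in> S \<Longrightarrow> s - of_int k * t \<in> S"
  obtains e where "e \<in> S" "\<And>s. s \<in> S \<Longrightarrow> \<exists>m::int. s = of_int m * e"
proof (cases "S = {0}")
  case True
  then show ?thesis using that[of 0] by auto
next
  case False
  then obtain s0 where s0: "s0 \<in> S" "s0 \<noteq> 0" using assms(2) by blast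
  have "0 - of_int 1 * s0 \<in> S" by (rule comb) (use assms(2) s0 in auto)
  then have "\<bar>s0\<bar> \<in> S" using s0 by (auto simp: abs_if)
  moreover obtain k where "s0 = of_int k" using s0 assms(1) by (auto elim: Ints_cases)
  ultimately have ex: "\<exists>n. n > 0 \<and> real n \<in> S"
    using s0(2) by (intro exI[of _ "nat \<bar>k\<bar>"]) auto
  define n where "n = (LEAST n. n > 0 \<and> real n \<in> S)"
  have n: "n > 0" "real n \<in> S" unfolding n_def using LeastI_ex[OF ex] by auto
  show ?thesis
  proof (rule that[of "real n"])
    fix s assume s: "s \<in> S"
    then obtain a where a: "s = of_int a" using assms(1) by (auto elim: Ints_cases)
    have "real_of_int (a mod int n) = s - of_int (a div int n) * real n"
      unfolding a minus_div_mult_eq_mod[symmetric] by simp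
    also have "\<dots> \<in> S" using comb[OF s n(2)] .
    finally have "real (nat (a mod int n)) \<in> S" using n(1) by simp
    moreover have "nat (a mod int n) < n" using n(1) by (simp add: nat_less_iff)
    ultimately have "\<not> nat (a mod int n) > 0"
      using not_less_Least[of "nat (a mod int n)" "\<lambda>n. n > 0 \<and> real n \<in> S", folded n_def] by metis
    then have "a mod int n = 0" using n(1) pos_mod_sign[of "int n" a] by linarith
    then have "a = (a div int n) * int n" using div_mult_mod_eq[of a "int n"] by simp
    then have "s = of_int ((a div int n) * int n)" unfolding a by simp
    then have "s = of_int (a div int n) * real n" by simp
    then show "\<exists>m::int. s = of_int m * real n" by blast
  qed (rule n(2))
qed

definition annihilator :: "('j \<Rightarrow> real^'m) \<Rightarrow> 'j set \<Rightarrow> (real^'m) set" where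
  "annihilator u J = {y. int_vec y \<and> (\<forall>j\<in>J. y \<bullet> u j = 0)}"

lemma annihilator_comb:
  "y \<in> annihilator u J \<Longrightarrow> y' \<in> annihilator u J \<Longrightarrow> y - of_int m *\<^sub>R y' \<in> annihilator u J"
  by (auto simp: annihilator_def inner_diff_left intro!: int_vec_diff int_vec_scaleR)

text \<open>The values \<open>y \<bullet> w\<close> on the annihilator form a subgroup of the
  integers; \<open>y1\<close> attains a generator, which may be \<open>0\<close>.\<close>

lemma annihilator_values_generator:
  assumes "int_vec w"
  obtains y1 where "y1 \<in> annihilator u J" "\<And>y. y \<in> annihilator u J \<Longrightarrow> \<exists>m::int. y \<bullet> w = of_int m * (y1 \<bullet> w)"
proof -
  obtain e where e: "e \<in> (\<lambda>y. y \<bullet> w) ` annihilator u J"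
    "\<And>s. s \<in> (\<lambda>y. y \<bullet> w) ` annihilator u J \<Longrightarrow> \<exists>m::int. s = of_int m * e"
  proof (rule subgroup_int_generator)
    show "(\<lambda>y. y \<bullet> w) ` annihilator u J \<subseteq> \<int>"
      using int_vec_inner assms by (auto simp: annihilator_def)
    have "0 \<in> annihilator u J" by (simp add: annihilator_def int_vec_def)
    then show "0 \<in> (\<lambda>y. y \<bullet> w) ` annihilator u J" by force
    fix s t k assume "s \<in> (\<lambda>y. y \<bullet> w) ` annihilator u J" "t \<in> (\<lambda>y. y \<bullet> w) ` annihilator u J"
    then obtain y y' where y: "y \<in> annihilator u J" "y' \<in> annihilator u J" "s = y \<bullet> w" "t = y' \<bullet> w" by auto
    then have "s - of_int k * t = (y - of_int k *\<^sub>R y') \<bullet> w" by (simp add: inner_diff_left)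
    then show "s - of_int k * t \<in> (\<lambda>y. y \<bullet> w) ` annihilator u J"
      using annihilator_comb[OF y(1,2)] by (metis image_eqI)
  qed metis
  then show ?thesis using that by (metis (no_types, lifting) imageE image_eqI)
qed

text \<open>Duality of lattices: a rational vector pairing integrally with every integer vector
  orthogonal to the \<open>u j\<close> is an integer vector modulo their rational span. The
  induction splits off one vector \<open>u k\<close> with a suitable coefficient.\<close>

lemma integral_on_annihilator:
  fixes u :: "'j \<Rightarrow> real^'m"
  assumes "finite J" "\<And>j. j \<in> J \<Longrightarrow> int_vec (u j)" "\<And>i. r $ i \<in> \<rat>"
    "\<And>y. y \<in> annihilator u J \<Longrightarrow> y \<bullet> r \<in> \<int>"
  shows "\<exists>z. (\<forall>j. z j \<in> \<rat>) \<and> int_vec (r - (\<Sum>j\<in>J. z j *\<^sub>R u j))"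
  using assms
proof (induction J arbitrary: r rule: finite_induct)
  case empty
  have "r $ i \<in> \<int>" for i
  proof -
    have "axis i 1 \<in> annihilator u {}" by (auto simp: annihilator_def int_vec_def axis_def)
    then have "axis i 1 \<bullet> r \<in> \<int>" using empty by blast
    then show ?thesis by (simp add: inner_axis')
  qed
  then show ?case by (intro exI[of _ "\<lambda>_. 0"]) (auto simp: int_vec_def)
next
  case (insert k J)
  obtain y1 where y1: "y1 \<in> annihilator u J"
    "\<And>y. y \<in> annihilator u J \<Longrightarrow> \<exists>m::int. y \<bullet> u k = of_int m * (y1 \<bullet> u k)"
    using annihilator_values_generator[of "u k" u J] insert.prems(1) by blast
  \<comment> \<open>If \<open>y1 \<bullet> u k\<close> is nonzero, this coefficient makes
    \<open>y1\<close> orthogonal to \<open>r - c *\<^sub>R u k\<close>. Otherwise division by zero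
    gives \<open>c = 0\<close>, and every \<open>y\<close> in the annihilator is already orthogonal
    to \<open>u k\<close>.\<close>
  define c where "c = (y1 \<bullet> r) / (y1 \<bullet> u k)"
  have rk: "u k $ i \<in> \<rat>" for i using insert.prems(1)[of k] Ints_subset_Rats by (auto simp: int_vec_def)
  have y1Q: "y1 $ i \<in> \<rat>" for i using y1(1) Ints_subset_Rats by (auto simp: annihilator_def int_vec_def)
  have cQ: "c \<in> \<rat>" unfolding c_def inner_vec_def
    using insert.prems(2) rk y1Q by (auto intro!: Rats_divide Rats_sum Rats_mult)
  have "y \<bullet> (r - c *\<^sub>R u k) \<in> \<int>" if y: "y \<in> annihilator u J" for y
  proof -
    obtain m :: int where m: "y \<bullet> u k = of_int m * (y1 \<bullet> u k)" using y1(2)[OF y] by blast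
    have "y - of_int (if y1 \<bullet> u k = 0 then 0 else m) *\<^sub>R y1 \<in> annihilator u (insert k J)"
      using annihilator_comb[OF y y1(1)] m by (auto simp: annihilator_def inner_diff_left)
    then have "(y - of_int (if y1 \<bullet> u k = 0 then 0 else m) *\<^sub>R y1) \<bullet> r \<in> \<int>" using insert.prems(3) by blast
    also have "(y - of_int (if y1 \<bullet> u k = 0 then 0 else m) *\<^sub>R y1) \<bullet> r = y \<bullet> (r - c *\<^sub>R u k)"
      using m by (simp add: c_def inner_diff_left inner_diff_right)
    finally show ?thesis .
  qed
  moreover have "(r - c *\<^sub>R u k) $ i \<in> \<rat>" for i
    using insert.prems(2) cQ rk by (auto intro!: Rats_diff Rats_mult)
  ultimately obtain z where z: "\<forall>j. z j \<in> \<rat>" "int_vec (r - c *\<^sub>R u k - (\<Sum>j\<in>J. z j *\<^sub>R u j))"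
    using insert.IH[of "r - c *\<^sub>R u k"] insert.prems(1) by blast
  have "(\<Sum>j\<in>J. (z(k := c)) j *\<^sub>R u j) = (\<Sum>j\<in>J. z j *\<^sub>R u j)"
    using insert.hyps by (intro sum.cong) auto
  then have eq: "r - (\<Sum>j\<in>insert k J. (z(k := c)) j *\<^sub>R u j) = r - c *\<^sub>R u k - (\<Sum>j\<in>J. z j *\<^sub>R u j)"
    using insert.hyps by simp
  have "int_vec (r - (\<Sum>j\<in>insert k J. (z(k := c)) j *\<^sub>R u j))" unfolding eq by (rule z(2))
  moreover have "\<forall>j. (z(k := c)) j \<in> \<rat>" using z(1) cQ by simp
  ultimately show ?case by blast
qed

text \<open>Kronecker's criterion for a linear system to have an integer solution: each rational
  combination of the rows that is integral must have an integral right-hand side. A solution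
  \<open>y0\<close> for \<open>J\<close> is corrected by a multiple of an annihilator element
  \<open>y1\<close> to satisfy the equation of \<open>k\<close>.\<close>

lemma kronecker_integer_solution:
  fixes u :: "'j \<Rightarrow> real^'m" and c :: "'j \<Rightarrow> real"
  assumes "finite J" "\<And>j. j \<in> J \<Longrightarrow> int_vec (u j)"
    "\<And>z. (\<And>j. z j \<in> \<rat>) \<Longrightarrow> int_vec (\<Sum>j\<in>J. z j *\<^sub>R u j) \<Longrightarrow> (\<Sum>j\<in>J. z j * c j) \<in> \<int>"
  shows "\<exists>y. int_vec y \<and> (\<forall>j\<in>J. y \<bullet> u j = c j)"
  using assms
proof (induction J rule: finite_induct)
  case empty
  then show ?case by (intro exI[of _ 0]) (simp add: int_vec_def)
next
  case (insert k J)
  have upd: "(\<Sum>j\<in>insert k J. (z(k := a)) j *\<^sub>R w j) = a *\<^sub>R w k + (\<Sum>j\<in>J. z j *\<^sub>R w j)"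
    for z :: "'j \<Rightarrow> real" and a :: real and w :: "'j \<Rightarrow> 'v::real_vector"
    using insert.hyps by (auto intro!: sum.cong)
  have upd': "(\<Sum>j\<in>insert k J. (z(k := a)) j * w j) = a * w k + (\<Sum>j\<in>J. z j * w j)"
    for z :: "'j \<Rightarrow> real" and a :: real and w
    using upd[of z a w] by simp
  have "(\<Sum>j\<in>J. z j * c j) \<in> \<int>" if z: "\<And>j. z j \<in> \<rat>" "int_vec (\<Sum>j\<in>J. z j *\<^sub>R u j)" for z
  proof -
    have "(\<Sum>j\<in>insert k J. (z(k := 0)) j * c j) \<in> \<int>"
    proof (rule insert.prems(2))
      show "(z(k := 0)) j \<in> \<rat>" for j using z(1) by simp
      show "int_vec (\<Sum>j\<in>insert k J. (z(k := 0)) j *\<^sub>R u j)" unfolding upd using z(2) by simp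
    qed
    then show ?thesis unfolding upd' by simp
  qed
  then obtain y0 where y0: "int_vec y0" "\<And>j. j \<in> J \<Longrightarrow> y0 \<bullet> u j = c j"
    using insert.IH insert.prems(1) by blast
  \<comment> \<open>By duality \<open>t *\<^sub>R u k\<close> is integral modulo a rational
    combination of the \<open>u j\<close>. The right-hand sides of that combination and its pairing
    with \<open>y0\<close> are both integral, and their difference is the claim.\<close>
  have key: "t * (c k - y0 \<bullet> u k) \<in> \<int>"
    if t: "t \<in> \<rat>" "\<And>y. y \<in> annihilator u J \<Longrightarrow> t * (y \<bullet> u k) \<in> \<int>" for t
  proof -
    have "u k $ i \<in> \<rat>" for i using insert.prems(1)[of k] Ints_subset_Rats by (auto simp: int_vec_def)
    then have uQ: "(t *\<^sub>R u k) $ i \<in> \<rat>" for i using t(1) by simp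
    obtain z where z: "\<forall>j. z j \<in> \<rat>" "int_vec (t *\<^sub>R u k - (\<Sum>j\<in>J. z j *\<^sub>R u j))"
      using integral_on_annihilator[of J u "t *\<^sub>R u k"] insert.hyps(1) insert.prems(1) uQ t(2)
      by auto
    have "(\<Sum>j\<in>insert k J. ((\<lambda>j. - z j)(k := t)) j * c j) \<in> \<int>"
    proof (rule insert.prems(2))
      show "((\<lambda>j. - z j)(k := t)) j \<in> \<rat>" for j using z(1) t(1) by simp
      show "int_vec (\<Sum>j\<in>insert k J. ((\<lambda>j. - z j)(k := t)) j *\<^sub>R u j)"
        unfolding upd using z(2) by (simp add: sum_negf)
    qed
    then have 1: "t * c k - (\<Sum>j\<in>J. z j * c j) \<in> \<int>" unfolding upd' by (simp add: sum_negf)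
    have "y0 \<bullet> (t *\<^sub>R u k - (\<Sum>j\<in>J. z j *\<^sub>R u j)) \<in> \<int>" by (rule int_vec_inner[OF y0(1) z(2)])
    then have 2: "t * (y0 \<bullet> u k) - (\<Sum>j\<in>J. z j * c j) \<in> \<int>"
      using y0(2) by (simp add: inner_diff_right inner_sum_right)
    show ?thesis using Ints_diff[OF 1 2] by (simp add: algebra_simps)
  qed
  obtain y1 where y1: "y1 \<in> annihilator u J"
    "\<And>y. y \<in> annihilator u J \<Longrightarrow> \<exists>m::int. y \<bullet> u k = of_int m * (y1 \<bullet> u k)"
    using annihilator_values_generator[of "u k" u J] insert.prems(1) by blast
  have e: "y1 \<bullet> u k \<in> \<int>" using y1(1) insert.prems(1) int_vec_inner by (auto simp: annihilator_def)
  show ?case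
  proof (cases "y1 \<bullet> u k = 0")
    case True
    have ckQ: "c k - y0 \<bullet> u k \<in> \<int>"
      using key[of 1] y1(2) True by force
    have "c k = y0 \<bullet> u k"
    proof (rule ccontr)
      assume ne: "c k \<noteq> y0 \<bullet> u k"
      \<comment> \<open>In this case \<open>u k\<close> is orthogonal to the annihilator, so
        \<open>key\<close> applies to every rational \<open>t\<close>; this one would make
        \<open>1 / 2\<close> an integer.\<close>
      define t where "t = 1 / (2 * (c k - y0 \<bullet> u k))"
      have "c k - y0 \<bullet> u k \<in> \<rat>" using ckQ Ints_subset_Rats by blast
      then have "t \<in> \<rat>" unfolding t_def by (intro Rats_divide Rats_mult) auto
      then have "t * (c k - y0 \<bullet> u k) \<in> \<int>"
      proof (rule key)
        fix y assume "y \<in> annihilator u J"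
        then have "y \<bullet> u k = 0" using y1(2) True by force
        then show "t * (y \<bullet> u k) \<in> \<int>" by simp
      qed
      moreover have "t * (c k - y0 \<bullet> u k) = 1 / 2"
        using ne unfolding t_def by (subst times_divide_eq_left, subst mult_1, subst divide_eq_eq) simp
      ultimately have "(1 / 2 :: real) \<in> \<int>" by simp
      then obtain m where "1/2 = real_of_int m" by (auto elim: Ints_cases)
      then have "real_of_int 1 = real_of_int (2 * m)" by simp
      then have "1 = 2 * m" by (simp only: of_int_eq_iff)
      then show False by presburger
    qed
    then show ?thesis using y0 by (intro exI[of _ y0]) auto
  next
    case False
    \<comment> \<open>With this \<open>t\<close>, \<open>key\<close> says that the error of
      \<open>y0\<close> in the equation of \<open>k\<close> is an integer multiple of
      \<open>y1 \<bullet> u k\<close>, and adding that multiple of \<open>y1\<close> removes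
      it.\<close>
    define t where "t = 1 / (y1 \<bullet> u k)"
    have "t \<in> \<rat>" unfolding t_def using e Ints_subset_Rats by (intro Rats_divide) auto
    then have "t * (c k - y0 \<bullet> u k) \<in> \<int>"
    proof (rule key)
      fix y assume "y \<in> annihilator u J"
      then obtain m :: int where "y \<bullet> u k = of_int m * (y1 \<bullet> u k)" using y1(2) by blast
      then show "t * (y \<bullet> u k) \<in> \<int>" using False by (simp add: t_def)
    qed
    then have "y0 + (t * (c k - y0 \<bullet> u k)) *\<^sub>R y1 \<in> {y. int_vec y \<and> (\<forall>j\<in>insert k J. y \<bullet> u j = c j)}"
      using y0 y1(1) False
      by (auto simp: annihilator_def inner_add_left t_def intro!: int_vec_add int_vec_scaleR)
    then show ?thesis by blast
  qed
qed

text \<open>Homogeneous coordinates turn the problem into an integer linear system; shifting a rational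
  solution by a large multiple of the sum of the vertices moves it into the cone over the polytope,
  where the assumption on denominators applies.\<close>
lemma affine_factorization:
  fixes G :: "real^'n \<Rightarrow> real^'k"
  assumes V: "rational_points V" "V \<noteq> {}" and G: "\<And>i. integer_affine (\<lambda>x. G x $ i)"
    and f: "integer_affine f"
    and den: "\<And>s x. s \<in> \<int> \<Longrightarrow> 0 < s \<Longrightarrow> x \<in> convex hull V \<Longrightarrow> int_vec (s *\<^sub>R G x) \<Longrightarrow> int_vec (s *\<^sub>R x)"
  obtains p where "integer_affine p" "\<And>x. x \<in> convex hull V \<Longrightarrow> p (G x) = f x"
proof -
  have finV: "finite V" using V(1) by (simp add: rational_points_def)
  have "finite (\<Union>v\<in>V. range (($) v))" "(\<Union>v\<in>V. range (($) v)) \<subseteq> \<rat>"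
    using V(1) by (auto simp: rational_points_def)
  then obtain D :: int where D: "D > 0" "\<And>r. r \<in> (\<Union>v\<in>V. range (($) v)) \<Longrightarrow> of_int D * (r::real) \<in> \<int>"
    using rational_common_denominator by blast
  have Dv: "of_int D * v $ i \<in> \<int>" if "v \<in> V" for v i using D(2) that by auto
  have DG: "of_int D * G v $ i \<in> \<int>" if "v \<in> V" for v i
    using integer_affine_Ints[OF G] Dv[OF that] by auto
  have Df: "of_int D * f v \<in> \<int>" if "v \<in> V" for v
    using integer_affine_Ints[OF f] Dv[OF that] by auto
  \<comment> \<open>The coordinate \<open>None\<close> is the homogenising one; in the solution it
    becomes the constant term of \<open>p\<close>. The factor \<open>D\<close> makes the rows
    integral.\<close>
  define u :: "real^'n \<Rightarrow> real^('k option)" where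
    "u v = (\<chi> i. of_int D * (case i of None \<Rightarrow> 1 | Some i \<Rightarrow> G v $ i))" for v
  have uint: "int_vec (u v)" if "v \<in> V" for v
    using DG[OF that] by (auto simp: u_def int_vec_def split: option.split)
  have "\<exists>y. int_vec y \<and> (\<forall>v\<in>V. y \<bullet> u v = of_int D * f v)"
  proof (rule kronecker_integer_solution[OF finV uint])
    fix z :: "real^'n \<Rightarrow> real"
    assume zQ: "\<And>v. z v \<in> \<rat>" and zint: "int_vec (\<Sum>v\<in>V. z v *\<^sub>R u v)"
    \<comment> \<open>The summand \<open>1\<close> makes the shift exceed every absolute value of
      \<open>z v\<close> strictly, so that all \<open>m v\<close> are positive.\<close>
    define k where "k = (\<Sum>v\<in>V. \<lceil>\<bar>z v\<bar>\<rceil>) + 1"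
    define m where "m v = z v + of_int k" for v
    have mpos: "m v > 0" if "v \<in> V" for v
    proof -
      have "\<lceil>\<bar>z v\<bar>\<rceil> \<le> (\<Sum>v\<in>V. \<lceil>\<bar>z v\<bar>\<rceil>)"
        using finV that by (intro member_le_sum) auto
      then have "\<bar>z v\<bar> < of_int k" unfolding k_def by linarith
      then show ?thesis by (simp add: m_def)
    qed
    define s where "s = (\<Sum>v\<in>V. m v * of_int D)"
    have spos: "s > 0" unfolding s_def using finV V(2) mpos D(1) by (intro sum_pos) auto
    \<comment> \<open>Replacing \<open>z\<close> by \<open>m\<close> adds an integer combination of
      integers, which does not affect integrality.\<close>
    have msum: "(\<Sum>v\<in>V. m v * (of_int D * h v)) \<in> \<int> \<longleftrightarrow> (\<Sum>v\<in>V. z v * (of_int D * h v)) \<in> \<int>"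
      if "\<And>v. v \<in> V \<Longrightarrow> of_int D * h v \<in> \<int>" for h :: "real^'n \<Rightarrow> real"
    proof -
      have eq: "(\<Sum>v\<in>V. m v * (of_int D * h v)) =
          (\<Sum>v\<in>V. z v * (of_int D * h v)) + of_int k * (\<Sum>v\<in>V. of_int D * h v)"
        by (simp add: m_def algebra_simps sum.distrib sum_distrib_left)
      have "of_int k * (\<Sum>v\<in>V. of_int D * h v) \<in> \<int>"
        by (rule Ints_mult[OF Ints_of_int]) (use that in \<open>rule Ints_sum\<close>)
      then show ?thesis unfolding eq by simp
    qed
    have "(\<Sum>v\<in>V. z v *\<^sub>R u v) $ None = (\<Sum>v\<in>V. z v * (of_int D * 1))" by (simp add: u_def)
    then have "(\<Sum>v\<in>V. z v * (of_int D * 1)) \<in> \<int>" using zint unfolding int_vec_def by metis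
    then have sint: "s \<in> \<int>" using msum[of "\<lambda>_. 1"] by (simp add: s_def)
    \<comment> \<open>The shifted combination of the \<open>u v\<close> has homogenising coordinate
      \<open>s\<close> and remaining coordinates \<open>s *\<^sub>R G x\<close>, so its integrality
      is what \<open>den\<close> requires at \<open>x\<close>.\<close>
    define x where "x = (\<Sum>v\<in>V. (m v * of_int D / s) *\<^sub>R v)"
    have w1: "(\<Sum>v\<in>V. m v * of_int D / s) = 1"
      using spos by (simp add: s_def flip: sum_divide_distrib)
    have xh: "x \<in> convex hull V" unfolding x_def
      by (rule convex_sum[OF finV convex_convex_hull w1]) (use mpos D(1) spos in \<open>auto intro: hull_inc less_imp_le\<close>)
    have comb: "s * p x = (\<Sum>v\<in>V. m v * (of_int D * p v))" if "integer_affine p" for p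
      unfolding x_def integer_affine_combination[OF that finV w1] sum_distrib_left
      using spos by (intro sum.cong) auto
    have "s * G x $ i \<in> \<int>" for i
    proof -
      have "(\<Sum>v\<in>V. z v *\<^sub>R u v) $ Some i = (\<Sum>v\<in>V. z v * (of_int D * G v $ i))" by (simp add: u_def)
      then have "(\<Sum>v\<in>V. z v * (of_int D * G v $ i)) \<in> \<int>" using zint unfolding int_vec_def by metis
      then show ?thesis unfolding comb[OF G] by (subst msum) (use DG in auto)
    qed
    then have "int_vec (s *\<^sub>R x)" by (intro den sint spos xh) (simp add: int_vec_def)
    then have "s * f x \<in> \<int>" by (intro integer_affine_Ints[OF f] sint) (simp add: int_vec_def)
    then show "(\<Sum>v\<in>V. z v * (of_int D * f v)) \<in> \<int>" unfolding comb[OF f] by (subst (asm) msum) (use Df in auto)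
  qed
  then obtain y where y: "int_vec y" "\<And>v. v \<in> V \<Longrightarrow> y \<bullet> u v = of_int D * f v" by blast
  define p :: "real^'k \<Rightarrow> real" where
    "p = (\<lambda>x. (\<Sum>i\<in>UNIV. of_int ((\<chi> i. \<lfloor>y $ Some i\<rfloor>) $ i) * x $ i) + of_int \<lfloor>y $ None\<rfloor>)"
  have p: "integer_affine p" unfolding integer_affine_def p_def by blast
  have yi: "of_int \<lfloor>y $ i\<rfloor> = y $ i" for i using y(1) by (auto simp: int_vec_def elim!: Ints_cases)
  have "p (G v) = f v" if "v \<in> V" for v
  proof -
    have "of_int D * p (G v) = y \<bullet> u v"
      by (simp add: p_def u_def inner_vec_def yi UNIV_option_conv sum.reindex algebra_simps sum_distrib_left)
    then show ?thesis using y(2)[OF that] D(1) by simp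
  qed
  then have "p (G x) = f x" if "x \<in> convex hull V" for x
    using integer_affine_le_on_hull[OF integer_affine_diff[OF integer_affine_compose[OF p G] f] _ that]
      integer_affine_le_on_hull[OF integer_affine_diff[OF f integer_affine_compose[OF p G]] _ that] by force
  then show ?thesis using that p by blast
qed

section \<open>Factorization through injective piecewise integer affine maps\<close>

text \<open>Locally the function is integer affine at the point considered, so a denominator of
  \<open>x\<close> is also one of \<open>f x\<close>: piecewise integer affine maps never create new
  denominators.\<close>

lemma int_pl_Ints:
  assumes "int_pl f" "s \<in> \<int>" "int_vec (s *\<^sub>R x)"
  shows "s * f x \<in> \<int>"
proof -
  obtain p where p: "integer_affine p" "f x = p x" using int_pl_pieces[OF assms(1)] by blast
  show ?thesis unfolding p(2)
    by (rule integer_affine_Ints[OF p(1) _ assms(2)]) (use assms(3) in \<open>simp add: int_vec_def\<close>)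
qed

lemma finite_integer_multiples_cube:
  assumes "0 < s"
  shows "finite {x :: real^'n. x \<in> unit_cube \<and> int_vec (s *\<^sub>R x)}"
proof (rule finite_subset)
  let ?K = "PiE (UNIV :: 'n set) (\<lambda>_. {0..\<lceil>s\<rceil>})"
  show "finite ((\<lambda>k. \<chi> i. of_int (k i) / s) ` ?K)" by (intro finite_imageI finite_PiE) auto
  show "{x :: real^'n. x \<in> unit_cube \<and> int_vec (s *\<^sub>R x)} \<subseteq> (\<lambda>k. \<chi> i. of_int (k i) / s) ` ?K"
  proof
    fix x :: "real^'n" assume "x \<in> {x. x \<in> unit_cube \<and> int_vec (s *\<^sub>R x)}"
    then have x: "\<And>i. 0 \<le> x $ i" "\<And>i. x $ i \<le> 1" "\<And>i. s * x $ i \<in> \<int>"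
      by (auto simp: mem_box_cart int_vec_def)
    define k where "k i = \<lfloor>s * x $ i\<rfloor>" for i
    have k: "of_int (k i) = s * x $ i" for i using x(3)[of i] by (auto simp: k_def elim!: Ints_cases)
    have "k i \<in> {0..\<lceil>s\<rceil>}" for i
    proof -
      have "0 \<le> s * x $ i" "s * x $ i \<le> s" using x(1,2)[of i] assms by (auto simp: mult_left_le)
      then show ?thesis unfolding k_def by (simp add: floor_le_iff le_ceiling_iff) linarith
    qed
    then have "k \<in> ?K" by auto
    moreover have "x = (\<chi> i. of_int (k i) / s)" using assms by (simp add: k vec_eq_iff)
    ultimately show "x \<in> (\<lambda>k. \<chi> i. of_int (k i) / s) ` ?K" by blast
  qed
qed

text \<open>The finite set of points whose denominator divides \<open>s\<close> is mapped into itself, hence permuted.\<close>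
lemma injective_int_pl_preserves_denominators:
  fixes g :: "real^'n \<Rightarrow> real^'n"
  assumes P: "P \<subseteq> unit_cube" and g: "g ` P \<subseteq> P" "inj_on g P" "\<And>i. int_pl (\<lambda>x. g x $ i)"
    and s: "s \<in> \<int>" "0 < s" and x: "x \<in> P" "int_vec (s *\<^sub>R g x)"
  shows "int_vec (s *\<^sub>R x)"
proof -
  let ?S = "{x \<in> P. int_vec (s *\<^sub>R x)}"
  have "finite ?S" by (rule finite_subset[OF _ finite_integer_multiples_cube[OF s(2)]]) (use P in auto)
  moreover have "g ` ?S \<subseteq> ?S"
    using g(1) int_pl_Ints[OF g(3) s(1)] by (auto simp: int_vec_def)
  moreover have "inj_on g ?S" by (rule inj_on_subset[OF g(2)]) auto
  ultimately have "g ` ?S = ?S" by (rule endo_inj_surj)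
  moreover have "g x \<in> ?S" using g(1) x by auto
  ultimately obtain x' where "x' \<in> ?S" "g x' = g x" by (metis (no_types, lifting) imageE)
  then show ?thesis using inj_onD[OF g(2)] x(1) by auto
qed

text \<open>On a refinement where \<open>a\<close> and \<open>b\<close> are both affine, the
  inequality needs checking only at the finitely many vertices. Each vertex has its own constant,
  and the sum of these constants serves all of them because \<open>b\<close> is nonnegative.\<close>

lemma int_pl_dominated:
  assumes P: "refinement P \<W>" and ab: "int_pl a" "int_pl b"
    and b0: "\<And>x. x \<in> P \<Longrightarrow> 0 \<le> b x" and zero: "\<And>x. x \<in> P \<Longrightarrow> b x = 0 \<Longrightarrow> a x \<le> 0"
  obtains N :: nat where "\<And>x. x \<in> P \<Longrightarrow> a x \<le> real N * b x"
proof -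
  obtain \<X> where \<X>: "refinement P \<X>" "\<And>X f. X \<in> \<X> \<Longrightarrow> f \<in> {a, b} \<Longrightarrow> affine_on_hull f X"
    using refinement_int_pl_finite[of "{a, b}", OF _ _ P] ab by blast
  have fin: "finite (\<Union>\<X>)" using \<X>(1) by (auto simp: refinement_def rational_points_def)
  have inP: "w \<in> P" if "w \<in> \<Union>\<X>" for w
  proof -
    obtain X where "X \<in> \<X>" "w \<in> X" using \<open>w \<in> \<Union>\<X>\<close> by blast
    then show ?thesis using hull_inc[of w X convex] \<X>(1) by (auto simp: refinement_def)
  qed
  have "\<exists>n::nat. a w \<le> real n * b w" if "w \<in> \<Union>\<X>" for w
  proof (cases "b w = 0")
    case True
    then show ?thesis using zero inP[OF that] by simp
  next
    case False
    then have "0 < b w" using b0[OF inP[OF that]] by simp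
    then show ?thesis using reals_Archimedean3 less_imp_le by blast
  qed
  then obtain n :: "_ \<Rightarrow> nat" where n: "\<And>w. w \<in> \<Union>\<X> \<Longrightarrow> a w \<le> real (n w) * b w" by metis
  define N where "N = (\<Sum>w\<in>\<Union>\<X>. n w)"
  have N: "a w \<le> real N * b w" if "w \<in> \<Union>\<X>" for w
  proof -
    have "n w \<le> N" unfolding N_def using fin that by (intro member_le_sum) auto
    then have "real (n w) * b w \<le> real N * b w" using b0[OF inP[OF that]] by (intro mult_right_mono) auto
    then show ?thesis using n[OF that] by simp
  qed
  have "a x \<le> real N * b x" if "x \<in> P" for x
  proof -
    obtain X where X: "X \<in> \<X>" "x \<in> convex hull X" using \<X>(1) \<open>x \<in> P\<close> by (auto simp: refinement_def)
    obtain p where p: "integer_affine p" "\<And>y. y \<in> convex hull X \<Longrightarrow> a y = p y"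
      using \<X>(2)[OF X(1), of a] by (auto simp: affine_on_hull_def)
    obtain q where q: "integer_affine q" "\<And>y. y \<in> convex hull X \<Longrightarrow> b y = q y"
      using \<X>(2)[OF X(1), of b] by (auto simp: affine_on_hull_def)
    have "p x - of_int (int N) * q x \<le> 0"
    proof (rule integer_affine_le_on_hull[OF _ _ X(2)])
      show "integer_affine (\<lambda>x. p x - of_int (int N) * q x)"
        by (intro integer_affine_diff integer_affine_cmult p q)
      fix v assume "v \<in> X"
      then show "p v - of_int (int N) * q v \<le> 0"
        using N[of v] X(1) p(2)[of v] q(2)[of v] by (auto simp: hull_inc)
    qed
    then show ?thesis using p(2)[OF X(2)] q(2)[OF X(2)] by simp
  qed
  then show ?thesis using that by blast
qed

text \<open>The function \<open>k\<close> is \<open>p + N q\<close>: \<open>p\<close> is the integer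
  affine factor on \<open>T\<close>, and the penalty \<open>q\<close> vanishes exactly on the image
  of the hull of \<open>T\<close>. A large \<open>N\<close> lifts \<open>k\<close> above
  \<open>f\<close> elsewhere without disturbing equality on \<open>T\<close>.\<close>

lemma factorization_touching_piece:
  fixes g :: "real^'n \<Rightarrow> real^'n"
  assumes P: "refinement P \<W>" "P \<subseteq> unit_cube"
    and g: "g ` P \<subseteq> P" "inj_on g P" "\<And>i. int_pl (\<lambda>x. g x $ i)" and f: "int_pl f"
    and T: "rational_points T" "T \<noteq> {}" "convex hull T \<subseteq> P"
      "affine_on_hull f T" "\<And>i. affine_on_hull (\<lambda>x. g x $ i) T"
  obtains k where "int_pl k" "\<And>x. x \<in> convex hull T \<Longrightarrow> k (g x) = f x" "\<And>x. x \<in> P \<Longrightarrow> f x \<le> k (g x)"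
proof -
  have finT: "finite T" using T(1) by (simp add: rational_points_def)
  obtain pf where pf: "integer_affine pf" "\<And>x. x \<in> convex hull T \<Longrightarrow> f x = pf x"
    using T(4) unfolding affine_on_hull_def by blast
  have "\<forall>i. \<exists>p. integer_affine p \<and> (\<forall>x\<in>convex hull T. g x $ i = p x)"
    using T(5) unfolding affine_on_hull_def by blast
  then obtain G' where G': "\<And>i. integer_affine (G' i)" "\<And>i x. x \<in> convex hull T \<Longrightarrow> g x $ i = G' i x"
    by metis
  define G :: "real^'n \<Rightarrow> real^'n" where "G x = (\<chi> i. G' i x)" for x
  have G: "integer_affine (\<lambda>x. G x $ i)" for i using G'(1) by (simp add: G_def)
  have gG: "g x = G x" if "x \<in> convex hull T" for x using G'(2)[OF that] by (simp add: G_def vec_eq_iff)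
  have "int_vec (s *\<^sub>R x)"
    if "s \<in> \<int>" "0 < s" "x \<in> convex hull T" "int_vec (s *\<^sub>R G x)" for s x
    using injective_int_pl_preserves_denominators[OF P(2) g that(1,2)] that T(3) gG by auto
  then obtain p where p: "integer_affine p" "\<And>x. x \<in> convex hull T \<Longrightarrow> p (G x) = pf x"
    using affine_factorization[OF T(1,2) G pf(1)] by blast
  have GTQ: "v $ i \<in> \<rat>" if "v \<in> G ` T" for v i
    using that integer_affine_Rats[OF G] T(1) by (auto simp: rational_points_def)
  obtain L where L: "finite L" "\<And>l. l \<in> L \<Longrightarrow> integer_affine l"
    "convex hull (G ` T) = {x. \<forall>l\<in>L. 0 \<le> l x}"
    using rational_hull_halfspaces[OF finite_imageI[OF finT] GTQ] by blast
  \<comment> \<open>The total violation of the inequalities describing the image polytope.\<close>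
  define q where "q y = (\<Sum>l\<in>L. max 0 (- l y))" for y
  have "int_pl (\<lambda>x. max 0 (- l x))" if "l \<in> L" for l
    using int_pl.max[OF int_pl_const[of 0] int_pl_uminus[OF int_pl.affine[OF L(2)[OF that]]]] by simp
  then have q: "int_pl q" unfolding q_def by (rule int_pl_sum[OF L(1)])
  have q0: "0 \<le> q y" for y by (auto simp: q_def intro: sum_nonneg)
  have qz: "q y = 0 \<longleftrightarrow> y \<in> convex hull (G ` T)" for y
    unfolding q_def L(3) by (subst sum_nonneg_eq_0_iff[OF L(1)]) (auto simp: max_def)
  have comb: "G (\<Sum>v\<in>T. \<mu> v *\<^sub>R v) = (\<Sum>v\<in>T. \<mu> v *\<^sub>R G v)" if "sum \<mu> T = 1" for \<mu>
    using integer_affine_combination[OF G finT that] by (simp add: vec_eq_iff)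
  have GT: "convex hull (G ` T) = G ` (convex hull T)"
  proof
    show "G ` (convex hull T) \<subseteq> convex hull (G ` T)"
    proof
      fix y assume "y \<in> G ` (convex hull T)"
      then obtain \<mu> where \<mu>: "\<And>v. v \<in> T \<Longrightarrow> 0 \<le> \<mu> v" "sum \<mu> T = 1" "y = (\<Sum>v\<in>T. \<mu> v *\<^sub>R G v)"
        using comb unfolding convex_hull_finite[OF finT] by auto
      show "y \<in> convex hull (G ` T)" unfolding \<mu>(3)
        by (rule convex_sum[OF finT convex_convex_hull \<mu>(2) \<mu>(1)]) (auto simp: hull_inc)
    qed
    have "convex (G ` (convex hull T))"
    proof -
      have "G (a *\<^sub>R x + b *\<^sub>R y) = a *\<^sub>R G x + b *\<^sub>R G y" if "a + b = 1" for a b x y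
      proof -
        have "p (a *\<^sub>R x + b *\<^sub>R y) = a * p x + b * p y" if "integer_affine p" for p
        proof -
          obtain c d where "\<And>x. p x = c \<bullet> x + d" using integer_affine_inner \<open>integer_affine p\<close> by blast
          moreover have "d = a * d + b * d" using \<open>a + b = 1\<close> by (simp flip: distrib_right)
          ultimately show ?thesis by (simp add: inner_add_right algebra_simps)
        qed
        from this[OF G] show ?thesis by (simp add: vec_eq_iff)
      qed
      then show ?thesis
        using convexD[OF convex_convex_hull[of T]] by (intro convexI) (auto simp: image_iff, metis)
    qed
    then show "convex hull (G ` T) \<subseteq> G ` (convex hull T)"
      by (intro hull_minimal) (auto simp: hull_inc)
  qed
  \<comment> \<open>Injectivity of \<open>g\<close> enters here: a point of \<open>P\<close> without
    penalty has the same image as a point of the hull of \<open>T\<close>, hence is that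
    point.\<close>
  have qT: "x \<in> convex hull T" if x: "x \<in> P" "q (g x) = 0" for x
  proof -
    obtain t where t: "t \<in> convex hull T" "g x = G t" using x(2) unfolding qz GT by blast
    then have "g x = g t" using gG by simp
    then show ?thesis using inj_onD[OF g(2)] x(1) t(1) T(3) by blast
  qed
  have ig: "int_pl (\<lambda>x. u (g x))" if "int_pl u" for u using int_pl_compose[OF that g(3)] .
  obtain N :: nat where N: "\<And>x. x \<in> P \<Longrightarrow> f x + - p (g x) \<le> real N * q (g x)"
  proof (rule int_pl_dominated[OF P(1)])
    show "int_pl (\<lambda>x. f x + - p (g x))" by (intro int_pl_add f int_pl_uminus ig int_pl.affine p)
    show "int_pl (\<lambda>x. q (g x))" by (rule ig[OF q])
    show "0 \<le> q (g x)" for x by (rule q0)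
    show "f x + - p (g x) \<le> 0" if "x \<in> P" "q (g x) = 0" for x
      using p(2) pf(2) gG qT[OF that] by simp
  qed blast
  show ?thesis
  proof (rule that)
    show "int_pl (\<lambda>y. p y + real N * q y)" by (intro int_pl_add int_pl_nat_mult q int_pl.affine p)
    show "p (g x) + real N * q (g x) = f x" if "x \<in> convex hull T" for x
    proof -
      have "q (g x) = 0" unfolding qz GT using gG that by blast
      then show ?thesis using p(2) pf(2) gG that by simp
    qed
    show "f x \<le> p (g x) + real N * q (g x)" if "x \<in> P" for x using N[OF that] by simp
  qed
qed

text \<open>Each piece of a subdivision carries a function of \<open>g\<close> which touches \<open>f\<close> there from above; their
  minimum is \<open>f\<close>.\<close>
lemma int_pl_factorization:
  fixes g :: "real^'n \<Rightarrow> real^'n"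
  assumes P: "refinement P \<W>" "P \<subseteq> unit_cube" "P \<noteq> {}"
    and g: "g ` P \<subseteq> P" "inj_on g P" "\<And>i. int_pl (\<lambda>x. g x $ i)" and f: "int_pl f"
  obtains k where "int_pl k" "\<And>x. x \<in> P \<Longrightarrow> f x = k (g x)"
proof -
  let ?\<Phi> = "insert f (range (\<lambda>i x. g x $ i))"
  have "finite ?\<Phi>" "int_pl h" if "h \<in> ?\<Phi>" for h using f g(3) that by auto
  then obtain \<X> where \<X>: "refinement P \<X>" "\<And>X h. X \<in> \<X> \<Longrightarrow> h \<in> ?\<Phi> \<Longrightarrow> affine_on_hull h X"
    using refinement_int_pl_finite[OF _ _ P(1), of ?\<Phi>] by (metis insertI1)
  \<comment> \<open>Empty vertex sets cover nothing and would admit no touching factor by the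
    previous lemma.\<close>
  define \<Y> where "\<Y> = \<X> - {{}}"
  have finY: "finite \<Y>" and cover: "P = (\<Union>T\<in>\<Y>. convex hull T)"
    using \<X>(1) by (auto simp: refinement_def \<Y>_def)
  have neY: "\<Y> \<noteq> {}" using cover P(3) by auto
  have "\<exists>k. int_pl k \<and> (\<forall>x\<in>convex hull T. k (g x) = f x) \<and> (\<forall>x\<in>P. f x \<le> k (g x))" if T: "T \<in> \<Y>" for T
  proof -
    have "rational_points T" "T \<noteq> {}" "convex hull T \<subseteq> P"
      using T \<X>(1) by (auto simp: \<Y>_def refinement_def)
    moreover have "affine_on_hull f T" "affine_on_hull (\<lambda>x. g x $ i) T" for i
      using T \<X>(2) by (auto simp: \<Y>_def)
    ultimately show ?thesis using factorization_touching_piece[OF P(1,2) g f] by metis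
  qed
  then obtain K where K: "\<And>T. T \<in> \<Y> \<Longrightarrow> int_pl (K T)"
    "\<And>T x. T \<in> \<Y> \<Longrightarrow> x \<in> convex hull T \<Longrightarrow> K T (g x) = f x"
    "\<And>T x. T \<in> \<Y> \<Longrightarrow> x \<in> P \<Longrightarrow> f x \<le> K T (g x)" by metis
  show ?thesis
  proof (rule that)
    show "int_pl (\<lambda>y. MIN T\<in>\<Y>. K T y)" by (rule int_pl_Min[OF finY neY K(1)])
    fix x assume x: "x \<in> P"
    then obtain T where T: "T \<in> \<Y>" "x \<in> convex hull T" using cover by blast
    show "f x = (MIN T\<in>\<Y>. K T (g x))"
    proof (rule antisym)
      show "f x \<le> (MIN T\<in>\<Y>. K T (g x))" using finY neY K(3) x by auto
      show "(MIN T\<in>\<Y>. K T (g x)) \<le> f x"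
        using K(2)[OF T] finY T(1) by (intro Min_le) force+
    qed
  qed
qed

text \<open>Each polytope of the cover has a defining inequality violated at \<open>y\<close>. The
  minimum of the violations stays positive at \<open>y\<close>, and at each point of
  \<open>P\<close> one of them is nonpositive.\<close>

lemma refinement_separation:
  assumes P: "refinement P \<W>" "P \<noteq> {}" and y: "y \<notin> P"
  obtains \<phi> where "int_pl \<phi>" "\<And>x. x \<in> P \<Longrightarrow> \<phi> x \<le> 0" "0 < \<phi> y"
proof -
  have "\<exists>l. integer_affine l \<and> (\<forall>x\<in>convex hull W. l x \<le> 0) \<and> 0 < l y" if "W \<in> \<W>" for W
  proof -
    have W: "finite W" "\<And>v i. v \<in> W \<Longrightarrow> v $ i \<in> \<rat>" "y \<notin> convex hull W"
      using that P(1) y by (auto simp: refinement_def rational_points_def)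
    obtain L where L: "finite L" "\<And>l. l \<in> L \<Longrightarrow> integer_affine l"
      "convex hull W = {x. \<forall>l\<in>L. 0 \<le> l x}"
      using rational_hull_halfspaces[OF W(1,2)] by blast
    then obtain l where "l \<in> L" "l y < 0" using W(3) by (auto simp: not_le)
    then show ?thesis using L integer_affine_uminus[of l] by (intro exI[of _ "\<lambda>x. - l x"]) auto
  qed
  then obtain l where l: "\<And>W. W \<in> \<W> \<Longrightarrow> integer_affine (l W)"
    "\<And>W x. W \<in> \<W> \<Longrightarrow> x \<in> convex hull W \<Longrightarrow> l W x \<le> 0" "\<And>W. W \<in> \<W> \<Longrightarrow> 0 < l W y" by metis
  have fin: "finite \<W>" "\<W> \<noteq> {}" using P by (auto simp: refinement_def)
  show ?thesis
  proof (rule that)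
    show "int_pl (\<lambda>x. MIN W\<in>\<W>. l W x)" by (intro int_pl_Min fin int_pl.affine l)
    show "0 < (MIN W\<in>\<W>. l W y)" using fin l(3) by simp
    fix x assume "x \<in> P"
    then obtain W where W: "W \<in> \<W>" "x \<in> convex hull W" using P(1) by (auto simp: refinement_def)
    then have "(MIN W\<in>\<W>. l W x) \<le> l W x" using fin by (intro Min_le) auto
    then show "(MIN W\<in>\<W>. l W x) \<le> 0" using l(2)[OF W] by simp
  qed
qed

section \<open>Characters of McNaughton algebras\<close>

text \<open>The right-hand side is the MV-term for the Lukasiewicz product of
  \<open>clip s \<oplus> t\<close> with \<open>clip (s + 1)\<close>; a homomorphism can therefore be
  moved inside the truncation of a sum.\<close>

lemma clip_add:
  assumes "0 \<le> t" "t \<le> 1"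
  shows "clip (s + t) = 1 - min 1 ((1 - min 1 (clip s + t)) + (1 - clip (s + 1)))"
  using assms by (auto simp: clip_def min_def max_def)

text \<open>The right-hand side is the MV-term of the lattice join, applied to the two
  truncations.\<close>

lemma clip_max: "clip (max s t) = min 1 (1 - min 1 (1 - clip s + clip t) + clip t)"
  by (auto simp: clip_def min_def max_def)

lemma clip_nonneg: "0 \<le> clip t"
  by (simp add: clip_def)

lemma clip_of_nonneg: "0 \<le> t \<Longrightarrow> clip t = min 1 t"
  by (auto simp: clip_def)

lemma clip_one_minus: "clip (1 - t) = 1 - clip t"
  by (auto simp: clip_def min_def max_def)

section \<open>MV-homomorphisms into the real unit interval are evaluations\<close>

context
  fixes P :: "(real^'n) set" and e :: "(real^'n \<Rightarrow> real) \<Rightarrow> real"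
  assumes P: "P \<subseteq> unit_cube"
    and e_range: "\<And>f. f \<in> carrier (mcn_algebra P) \<Longrightarrow> e f \<in> {0..1}"
    and e_zero: "e (\<lambda>x\<in>P. 0) = 0"
    and e_neg: "\<And>f. f \<in> carrier (mcn_algebra P) \<Longrightarrow> e (\<lambda>x\<in>P. 1 - f x) = 1 - e f"
    and e_plus: "\<And>f g. f \<in> carrier (mcn_algebra P) \<Longrightarrow> g \<in> carrier (mcn_algebra P) \<Longrightarrow>
      e (\<lambda>x\<in>P. min 1 (f x + g x)) = min 1 (e f + e g)"
begin

text \<open>Extends \<open>e\<close> to arbitrary \<open>int_pl\<close> functions by truncation,
  since intermediate sums leave the unit interval.\<close>

private definition ev :: "(real^'n \<Rightarrow> real) \<Rightarrow> real" where
  "ev u = e (\<lambda>x\<in>P. clip (u x))"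

text \<open>The only candidate for the point of evaluation. It is not yet known to lie in
  \<open>P\<close>, so later statements apply the total function \<open>u\<close> to it.\<close>

private definition point :: "real^'n" where
  "point = (\<chi> i. e (\<lambda>x\<in>P. x $ i))"

text \<open>The claim is proved together with all its integer translates, as the formula for
  \<open>clip (s + t)\<close> involves \<open>clip (s + 1)\<close>.\<close>
private definition good :: "(real^'n \<Rightarrow> real) \<Rightarrow> bool" where
  "good u \<longleftrightarrow> int_pl u \<and> (\<forall>b::int. ev (\<lambda>x. u x + of_int b) = clip (u point + of_int b))"

private lemma clip_carrier: "int_pl u \<Longrightarrow> (\<lambda>x\<in>P. clip (u x)) \<in> carrier (mcn_algebra P)"
  using mcnaughton_clip by (auto simp: mcn_algebra_def)

private lemma ev_neg: "int_pl u \<Longrightarrow> ev (\<lambda>x. 1 - u x) = 1 - ev u"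
proof -
  assume u: "int_pl u"
  have "(\<lambda>x\<in>P. clip (1 - u x)) = (\<lambda>x\<in>P. 1 - (\<lambda>x\<in>P. clip (u x)) x)"
    by (rule restrict_ext) (auto simp: clip_def min_def max_def)
  then show ?thesis unfolding ev_def using e_neg[OF clip_carrier[OF u]] by simp
qed

private lemma ev_plus:
  assumes "int_pl u" "int_pl v"
  shows "ev (\<lambda>x. clip (u x) + clip (v x)) = min 1 (ev u + ev v)"
proof -
  have "(\<lambda>x\<in>P. clip (clip (u x) + clip (v x))) =
      (\<lambda>x\<in>P. min 1 ((\<lambda>x\<in>P. clip (u x)) x + (\<lambda>x\<in>P. clip (v x)) x))"
    by (rule restrict_ext) (auto simp: clip_def min_def max_def)
  then show ?thesis unfolding ev_def using e_plus[OF assms[THEN clip_carrier]] by simp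
qed

private lemma ev_cong: "(\<And>x. x \<in> P \<Longrightarrow> clip (u x) = clip (v x)) \<Longrightarrow> ev u = ev v"
  unfolding ev_def by (simp cong: restrict_cong)

private lemma int_pl_shift: "int_pl u \<Longrightarrow> int_pl (\<lambda>x. u x + of_int b)"
  by (intro int_pl_add int_pl_const)

private lemma int_pl_one_minus: "int_pl u \<Longrightarrow> int_pl (\<lambda>x. 1 - u x)"
  using int_pl_add[OF int_pl_const[of 1] int_pl_uminus] by simp

private lemma good_shift: "good u \<Longrightarrow> good (\<lambda>x. u x + of_int c)"
  unfolding good_def using int_pl_shift
  by (auto simp: add.assoc simp flip: of_int_add)

private lemma good_zero: "good (\<lambda>x. 0)"
  unfolding good_def
proof (intro conjI allI)
  show "int_pl (\<lambda>x::real^'n. 0)" using int_pl_const[of 0] by simp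
  fix b :: int
  have zero: "ev (\<lambda>x. 0) = 0" using e_zero by (simp add: ev_def clip_def)
  show "ev (\<lambda>x. 0 + of_int b) = clip (0 + of_int b)"
  proof (cases "b \<le> 0")
    case True
    then have c: "clip (of_int b) = 0" by (simp add: clip_def)
    then have "ev (\<lambda>x. of_int b) = ev (\<lambda>x. 0)" by (intro ev_cong) (simp add: clip_def)
    then show ?thesis using zero c by simp
  next
    case False
    then have c: "clip (of_int b) = 1" by (simp add: clip_def)
    then have "ev (\<lambda>x. of_int b) = ev (\<lambda>x. 1 - 0)" by (intro ev_cong) (simp add: clip_def)
    also have "\<dots> = 1" using ev_neg[OF \<open>int_pl (\<lambda>x::real^'n. 0)\<close>] zero by simp
    finally show ?thesis using c by simp
  qed
qed

text \<open>A summand with values in the unit interval can be added by \<open>clip_add\<close>; its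
  two truncations at \<open>s\<close> and \<open>s + 1\<close> are known because \<open>u\<close> is
  good together with its translates.\<close>

private lemma good_add:
  assumes u: "good u" and v: "int_pl v" "\<And>x. x \<in> P \<Longrightarrow> v x \<in> {0..1}" "ev v = v point"
  shows "good (\<lambda>x. u x + v x)"
  unfolding good_def
proof (intro conjI allI)
  have iu: "int_pl u" using u by (simp add: good_def)
  show "int_pl (\<lambda>x. u x + v x)" using iu v(1) by (rule int_pl_add)
  fix b :: int
  define s where "s = (\<lambda>x. u x + of_int b)"
  have iS: "int_pl s" "int_pl (\<lambda>x. s x + 1)"
    using int_pl_shift[OF iu, of b] int_pl_shift[OF iu, of "b + 1"] by (simp_all add: s_def add.assoc)
  have es: "ev s = clip (s point)" "ev (\<lambda>x. s x + 1) = clip (s point + 1)"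
  proof -
    have *: "ev (\<lambda>x. u x + of_int b) = clip (u point + of_int b)" for b
      using u by (simp add: good_def)
    show "ev s = clip (s point)" using *[of b] unfolding s_def .
    show "ev (\<lambda>x. s x + 1) = clip (s point + 1)"
      using *[of "b + 1"] unfolding s_def by (simp add: add.assoc)
  qed
  \<comment> \<open>The term of \<open>clip_add\<close> is spelled with a truncation at each level,
    so that \<open>ev_plus\<close> and \<open>ev_neg\<close> evaluate it from outside in.\<close>
  let ?a = "\<lambda>x. clip (s x) + clip (v x)"
  let ?b = "\<lambda>x. clip (1 - ?a x) + clip (1 - (s x + 1))"
  have ia: "int_pl ?a" by (intro int_pl_add int_pl_clip iS v)
  have ib: "int_pl ?b" by (intro int_pl_add int_pl_clip int_pl_one_minus iS v)
  have "ev (\<lambda>x. s x + v x) = ev (\<lambda>x. 1 - ?b x)"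
  proof (rule ev_cong)
    fix x assume "x \<in> P"
    then have "v x \<in> {0..1}" using v(2) by blast
    then have v01: "0 \<le> v x" "v x \<le> 1" by auto
    have "clip (?a x) = min 1 (clip (s x) + v x)"
      using v01 by (simp add: clip_of_nonneg clip_nonneg clip_id)
    moreover have "clip (?b x) = min 1 (?b x)" by (simp add: clip_of_nonneg clip_nonneg)
    ultimately show "clip (s x + v x) = clip (1 - ?b x)"
      unfolding clip_add[OF v01] clip_one_minus by simp
  qed
  also have "\<dots> = 1 - min 1 ((1 - min 1 (clip (s point) + v point)) + (1 - clip (s point + 1)))"
    using ev_neg[OF ib] ev_plus[OF int_pl_one_minus[OF ia] int_pl_one_minus[OF iS(2)]]
      ev_neg[OF ia] ev_neg[OF iS(2)] ev_plus[OF iS(1) v(1)] es v(3) by simp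
  also have "\<dots> = clip (s point + v point)"
  proof -
    have "ev v \<in> {0..1}" unfolding ev_def by (rule e_range[OF clip_carrier[OF v(1)]])
    then show ?thesis by (subst clip_add) (use v(3) in auto)
  qed
  finally show "ev (\<lambda>x. u x + v x + of_int b) = clip (u point + v point + of_int b)"
    by (simp add: s_def add_ac)
qed

private lemma coord_P: "x \<in> P \<Longrightarrow> x $ i \<in> {0..1}"
  using P by (auto simp: mem_box_cart)

private lemma ev_coord: "ev (\<lambda>x. x $ i) = point $ i"
proof -
  have "(\<lambda>x\<in>P. clip (x $ i)) = (\<lambda>x\<in>P. x $ i)"
    using coord_P by (intro restrict_ext) (auto simp: clip_id)
  then show ?thesis by (simp add: ev_def point_def)
qed

private lemma good_add_coord: "good u \<Longrightarrow> good (\<lambda>x. u x + x $ i)"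
  by (rule good_add) (use coord_P ev_coord in \<open>auto intro: int_pl.affine integer_affine_coord\<close>)

text \<open>The negated coordinate leaves the unit interval, so \<open>1 - x $ i\<close> is added
  instead and the result is translated by \<open>-1\<close>.\<close>

private lemma good_diff_coord:
  assumes "good u" shows "good (\<lambda>x. u x - x $ i)"
proof -
  have ic: "int_pl (\<lambda>x::real^'n. x $ i)" by (intro int_pl.affine integer_affine_coord)
  have "good (\<lambda>x. u x + (1 - x $ i))"
    by (rule good_add[OF assms int_pl_one_minus[OF ic]])
      (use coord_P ev_neg[OF ic] ev_coord in auto)
  from good_shift[OF this, of "- 1"] show ?thesis by simp
qed

private lemma good_add_coord_mult:
  assumes "good u" shows "good (\<lambda>x. u x + of_int c * x $ i)"
proof -
  have pos: "good (\<lambda>x. u x + of_nat n * x $ i)" for n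
  proof (induction n)
    case (Suc n)
    from good_add_coord[OF this, of i] show ?case by (simp add: algebra_simps)
  qed (use assms in simp)
  have neg: "good (\<lambda>x. u x - of_nat n * x $ i)" for n
  proof (induction n)
    case (Suc n)
    from good_diff_coord[OF this, of i] show ?case by (simp add: algebra_simps)
  qed (use assms in simp)
  show ?thesis
  proof (cases "c \<ge> 0")
    case True
    then show ?thesis using pos[of "nat c"] by simp
  next
    case False
    then show ?thesis using neg[of "nat (- c)"] by simp
  qed
qed

private lemma good_affine: "integer_affine p \<Longrightarrow> good p"
proof -
  assume "integer_affine p"
  then obtain a b where
    p: "p = (\<lambda>x. (\<Sum>i\<in>UNIV. of_int (a $ i) * x $ i) + of_int b)"
    unfolding integer_affine_def by blast
  have "good (\<lambda>x. \<Sum>i\<in>I. of_int (a $ i) * x $ i)" if "finite I" for I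
    using that
  proof (induction I rule: finite_induct)
    case (insert i I)
    from good_add_coord_mult[OF insert.IH, of "a $ i" i] show ?case
      using insert.hyps by (simp add: add.commute)
  qed (simp add: good_zero)
  from good_shift[OF this[of UNIV], of b] show ?thesis by (simp add: p)
qed

private lemma good_max:
  assumes "good u" "good v" shows "good (\<lambda>x. max (u x) (v x))"
  unfolding good_def
proof (intro conjI allI)
  have i: "int_pl u" "int_pl v" using assms by (auto simp: good_def)
  then show "int_pl (\<lambda>x. max (u x) (v x))" by (rule int_pl.max)
  fix b :: int
  define s where "s = (\<lambda>x. u x + of_int b)"
  define t where "t = (\<lambda>x. v x + of_int b)"
  have ist: "int_pl s" "int_pl t" unfolding s_def t_def by (intro int_pl_shift i)+
  have est: "ev s = clip (s point)" "ev t = clip (t point)"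
    using assms unfolding s_def t_def good_def by blast+
  let ?a = "\<lambda>x. clip (1 - s x) + clip (t x)"
  let ?b = "\<lambda>x. clip (1 - ?a x) + clip (t x)"
  have ia: "int_pl ?a" by (intro int_pl_add int_pl_clip int_pl_one_minus ist)
  have "ev (\<lambda>x. max (u x) (v x) + of_int b) = ev ?b"
  proof (rule ev_cong)
    fix x
    have m: "max (u x) (v x) + of_int b = max (s x) (t x)"
      by (simp add: s_def t_def max_add_distrib_left)
    have a: "clip (1 - clip (s x) + clip (t x)) = min 1 (1 - clip (s x) + clip (t x))"
      by (rule clip_of_nonneg) (auto simp: clip_def)
    have "clip (?b x) = min 1 (?b x)" by (rule clip_of_nonneg) (simp add: clip_nonneg)
    also have "\<dots> = min 1 (1 - min 1 (1 - clip (s x) + clip (t x)) + clip (t x))"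
      unfolding clip_one_minus a ..
    finally show "clip (max (u x) (v x) + of_int b) = clip (?b x)" unfolding m clip_max by simp
  qed
  also have "\<dots> = min 1 (1 - min 1 (1 - clip (s point) + clip (t point)) + clip (t point))"
    using ev_plus[OF int_pl_one_minus[OF ia] ist(2)] ev_neg[OF ia]
      ev_plus[OF int_pl_one_minus[OF ist(1)] ist(2)] ev_neg[OF ist(1)] est by simp
  also have "\<dots> = clip (max (s point) (t point))" by (rule clip_max[symmetric])
  finally show "ev (\<lambda>x. max (u x) (v x) + of_int b) = clip (max (u point) (v point) + of_int b)"
    by (simp add: s_def t_def max_add_distrib_left)
qed

private lemma good_uminus:
  assumes "good u" shows "good (\<lambda>x. - u x)"
  unfolding good_def
proof (intro conjI allI)
  have i: "int_pl u" using assms by (auto simp: good_def)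
  then show "int_pl (\<lambda>x. - u x)" by (rule int_pl_uminus)
  fix b :: int
  have "ev (\<lambda>x. u x + of_int (1 - b)) = clip (u point + of_int (1 - b))"
    using assms unfolding good_def by blast
  then have "ev (\<lambda>x. 1 - (u x + of_int (1 - b))) = 1 - clip (u point + of_int (1 - b))"
    by (simp only: ev_neg[OF int_pl_shift[OF i]])
  also have "\<dots> = clip (- u point + of_int b)" by (auto simp: clip_def min_def max_def)
  finally show "ev (\<lambda>x. - u x + of_int b) = clip (- u point + of_int b)" by simp
qed

private lemma good_int_pl: "int_pl u \<Longrightarrow> good u"
proof (induction rule: int_pl.induct)
  case (min f g)
  from good_uminus[OF good_max[OF min.IH[THEN good_uminus]]] show ?case
    by (simp add: minus_max_eq_min)
qed (auto intro: good_affine good_max)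

text \<open>A character is determined by its values on the coordinate functions: affine functions
  are built by adding coordinates one at a time, and max and min are MV-terms in
  truncations.\<close>

lemma character_is_evaluation:
  assumes "int_pl u"
  shows "e (\<lambda>x\<in>P. clip (u x)) = clip (u (\<chi> i. e (\<lambda>x\<in>P. x $ i)))"
proof -
  have "ev (\<lambda>x. u x + of_int 0) = clip (u point + of_int 0)"
    using good_int_pl[OF assms] unfolding good_def by blast
  then show ?thesis by (simp add: ev_def point_def)
qed

end

section \<open>Separating subalgebras and epi-subalgebras\<close>

lemma rational_polyhedron_refinement:
  assumes "rational_polyhedron P"
  obtains \<W> where "refinement P \<W>"
proof -
  obtain \<S> where S: "finite \<S>" "\<forall>S\<in>\<S>. rational_simplex S" "P = \<Union>\<S>"
    using assms unfolding rational_polyhedron_def by blast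
  have "\<forall>S\<in>\<S>. \<exists>V. rational_points V \<and> S = convex hull V"
    using S(2) unfolding rational_simplex_def rational_points_def by metis
  then obtain V where "\<And>S. S \<in> \<S> \<Longrightarrow> rational_points (V S) \<and> S = convex hull (V S)" by metis
  then have "refinement P (V ` \<S>)" using S(1,3) by (auto simp: refinement_def)
  then show ?thesis using that by blast
qed

lemma mcn_algebra_simps [simp]:
  "f \<oplus>\<^bsub>mcn_algebra P\<^esub> g = (\<lambda>x\<in>P. min 1 (f x + g x))"
  "\<sim>\<^bsub>mcn_algebra P\<^esub> f = (\<lambda>x\<in>P. 1 - f x)"
  "\<zero>\<^bsub>mcn_algebra P\<^esub> = (\<lambda>x\<in>P. 0)"
  by (simp_all add: mcn_algebra_def)

lemma clip_in_mcn_algebra: "int_pl u \<Longrightarrow> (\<lambda>x\<in>P. clip (u x)) \<in> carrier (mcn_algebra P)"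
  using mcnaughton_clip by (auto simp: mcn_algebra_def)

lemma mcn_algebra_int_pl:
  assumes "P \<subseteq> unit_cube" "f \<in> carrier (mcn_algebra P)"
  obtains \<phi> where "int_pl \<phi>" "f = (\<lambda>x\<in>P. clip (\<phi> x))"
proof -
  obtain m where m: "mcnaughton m" "f = restrict m P" using assms(2) by (auto simp: mcn_algebra_def)
  obtain \<phi> where \<phi>: "int_pl \<phi>" "\<And>x. x \<in> unit_cube \<Longrightarrow> m x = \<phi> x"
    using mcnaughton_imp_int_pl[OF m(1)] by blast
  have "m x = clip (\<phi> x)" if "x \<in> P" for x
  proof -
    have "m x \<in> {0..1}" using m(1) assms(1) that by (auto simp: mcnaughton_def Pi_iff)
    then show ?thesis using \<phi>(2)[of x] assms(1) that by (auto simp: clip_id)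
  qed
  then have "f = (\<lambda>x\<in>P. clip (\<phi> x))" unfolding m(2) by (rule restrict_ext)
  then show ?thesis using that \<phi>(1) by blast
qed

lemma mcn_algebra_range:
  assumes "P \<subseteq> unit_cube" "f \<in> carrier (mcn_algebra P)" "x \<in> P"
  shows "f x \<in> {0..1}"
  using assms by (auto simp: mcn_algebra_def mcnaughton_def Pi_iff)

lemma mcn_algebra_restrict: "f \<in> carrier (mcn_algebra P) \<Longrightarrow> restrict f P = f"
  by (auto simp: mcn_algebra_def)

lemma coord_clip:
  assumes "P \<subseteq> unit_cube"
  shows "(\<lambda>x\<in>P. x $ i) = (\<lambda>x\<in>P. clip (x $ i))"
  by (rule restrict_ext) (use assms in \<open>auto simp: mem_box_cart clip_id subset_iff\<close>)

lemma coord_in_mcn_algebra: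
  fixes P :: "(real^'n) set"
  assumes "P \<subseteq> unit_cube"
  shows "(\<lambda>x\<in>P. x $ i) \<in> carrier (mcn_algebra P)"
  unfolding coord_clip[OF assms]
  by (intro clip_in_mcn_algebra int_pl.affine integer_affine_coord)

lemma separating_mcn_algebra:
  fixes P :: "(real^'n) set"
  assumes "P \<subseteq> unit_cube"
  shows "separating P (carrier (mcn_algebra P))"
  unfolding separating_def
proof (intro ballI impI)
  fix x y assume xy: "x \<in> P" "y \<in> P" "x \<noteq> y"
  then obtain i where "x $ i \<noteq> y $ i" by (auto simp: vec_eq_iff)
  then show "\<exists>f\<in>carrier (mcn_algebra P). f x \<noteq> f y"
    using xy by (intro bexI[OF _ coord_in_mcn_algebra[OF assms, of i]]) simp
qed

text \<open>For \<open>x\<close> in \<open>P\<close>, the map sending \<open>f\<close> to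
  \<open>\<psi> f x\<close> is a character, hence evaluation at a point \<open>g x\<close>. Thus
  \<psi> is composition with \<open>g\<close>, and factoring a function through \<open>g\<close>
  produces its preimage.\<close>

lemma separating_image_full:
  fixes P :: "(real^'n) set"
  assumes P: "rational_polyhedron P"
    and \<psi>: "\<psi> \<in> mv_hom (mcn_algebra P) (mcn_algebra P)"
    and sep: "separating P (\<psi> ` carrier (mcn_algebra P))"
  shows "carrier (mcn_algebra P) \<subseteq> \<psi> ` carrier (mcn_algebra P)"
proof (cases "P = {}")
  case True
  \<comment> \<open>Over the empty set all restrictions coincide, so the algebra has one
    element.\<close>
  have "restrict f {} = restrict g ({} :: (real^'n) set)" for f g :: "_ \<Rightarrow> real" by auto
  then have "f = g" if "f \<in> carrier (mcn_algebra P)" "g \<in> carrier (mcn_algebra P)" for f g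
    using that mcn_algebra_restrict[of _ P] unfolding True by metis
  moreover have "\<psi> f \<in> carrier (mcn_algebra P)" if "f \<in> carrier (mcn_algebra P)" for f
    using that \<psi> by (auto simp: mv_hom_def)
  ultimately show ?thesis by blast
next
  case False
  let ?M = "carrier (mcn_algebra P)"
  obtain \<W> where W: "refinement P \<W>" using rational_polyhedron_refinement[OF P] .
  have cube: "P \<subseteq> unit_cube" using P by (simp add: rational_polyhedron_def)
  have \<psi>M: "\<psi> f \<in> ?M" if "f \<in> ?M" for f using that \<psi> by (auto simp: mv_hom_def)
  have "\<exists>\<gamma>. int_pl \<gamma> \<and> \<psi> (\<lambda>x\<in>P. x $ i) = (\<lambda>x\<in>P. clip (\<gamma> x))" for i
    using mcn_algebra_int_pl[OF cube \<psi>M[OF coord_in_mcn_algebra[OF cube]]] by metis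
  then obtain \<gamma> where \<gamma>: "\<And>i. int_pl (\<gamma> i)" "\<And>i. \<psi> (\<lambda>x\<in>P. x $ i) = (\<lambda>x\<in>P. clip (\<gamma> i x))" by metis
  define g :: "real^'n \<Rightarrow> real^'n" where "g x = (\<chi> i. clip (\<gamma> i x))" for x
  have gpl: "int_pl (\<lambda>x. g x $ i)" for i using int_pl_clip[OF \<gamma>(1)] by (simp add: g_def)
  have eval: "\<psi> (\<lambda>y\<in>P. clip (u y)) x = clip (u (g x))" if "int_pl u" and x: "x \<in> P" for u x
  proof -
    have "(\<lambda>f. \<psi> f x) (\<lambda>y\<in>P. clip (u y)) = clip (u (\<chi> i. (\<lambda>f. \<psi> f x) (\<lambda>y\<in>P. y $ i)))"
    proof (rule character_is_evaluation[OF cube _ _ _ _ \<open>int_pl u\<close>])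
      show "\<psi> f x \<in> {0..1}" if "f \<in> ?M" for f using mcn_algebra_range[OF cube \<psi>M[OF that] x] .
      show "\<psi> (\<lambda>x\<in>P. 0) x = 0" using \<psi> x by (simp add: mv_hom_def)
      show "\<psi> (\<lambda>x\<in>P. 1 - f x) x = 1 - \<psi> f x" if "f \<in> ?M" for f
        using \<psi> x that by (simp add: mv_hom_def)
      show "\<psi> (\<lambda>x\<in>P. min 1 (f x + h x)) x = min 1 (\<psi> f x + \<psi> h x)" if "f \<in> ?M" "h \<in> ?M" for f h
        using \<psi> x that by (simp add: mv_hom_def)
    qed
    moreover have "(\<chi> i. (\<lambda>f. \<psi> f x) (\<lambda>y\<in>P. y $ i)) = g x"
      using x by (simp add: \<gamma>(2) g_def)
    ultimately show ?thesis by simp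
  qed
  have gP: "g ` P \<subseteq> P"
  proof
    fix y assume "y \<in> g ` P"
    then obtain x where x: "x \<in> P" "y = g x" by blast
    show "y \<in> P"
    proof (rule ccontr)
      assume "y \<notin> P"
      \<comment> \<open>The truncation of \<phi> is zero on \<open>P\<close>, so \<psi> sends it to
        zero, although it is positive at the point \<open>y\<close> where it would be
        evaluated.\<close>
      then obtain \<phi> where \<phi>: "int_pl \<phi>" "\<And>x. x \<in> P \<Longrightarrow> \<phi> x \<le> 0" "0 < \<phi> y"
        using refinement_separation[OF W False] by blast
      have "clip (\<phi> z) = 0" if "z \<in> P" for z
        using \<phi>(2)[OF that] by (auto simp: clip_def max_def min_def)
      then have "(\<lambda>x\<in>P. clip (\<phi> x)) = (\<lambda>x\<in>P. 0)" by (rule restrict_ext)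
      then have "\<psi> (\<lambda>x\<in>P. clip (\<phi> x)) x = 0" using \<psi> x(1) by (simp add: mv_hom_def)
      then have "clip (\<phi> y) = 0" using eval[OF \<phi>(1) x(1)] x(2) by simp
      then show False using \<phi>(3) by (simp add: clip_def max_def min_def split: if_splits)
    qed
  qed
  have ginj: "inj_on g P"
  proof (rule inj_onI)
    fix x y assume xy: "x \<in> P" "y \<in> P" "g x = g y"
    have "f x = f y" if f: "f \<in> \<psi> ` ?M" for f
    proof -
      obtain h where h: "h \<in> ?M" "f = \<psi> h" using f by blast
      obtain u where "int_pl u" "h = (\<lambda>x\<in>P. clip (u x))" using mcn_algebra_int_pl[OF cube h(1)] .
      then show ?thesis using eval xy h(2) by simp
    qed
    then show "x = y" using sep xy(1,2) unfolding separating_def by blast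
  qed
  show ?thesis
  proof
    fix f assume f: "f \<in> ?M"
    obtain u where u: "int_pl u" "f = (\<lambda>x\<in>P. clip (u x))" using mcn_algebra_int_pl[OF cube f] .
    obtain k where k: "int_pl k" "\<And>x. x \<in> P \<Longrightarrow> u x = k (g x)"
      using int_pl_factorization[OF W cube False gP ginj gpl u(1)] by blast
    let ?h = "\<lambda>x\<in>P. clip (k x)"
    have hM: "?h \<in> ?M" by (rule clip_in_mcn_algebra[OF k(1)])
    have "f = restrict (\<psi> ?h) P" unfolding u(2)
      by (rule restrict_ext) (simp add: eval[OF k(1)] k(2))
    also have "\<dots> = \<psi> ?h" by (rule mcn_algebra_restrict[OF \<psi>M[OF hM]])
    finally show "f \<in> \<psi> ` ?M" using hM by blast
  qed
qed

text \<open>The inverse map cancels \<open>h\<close> only on the carrier of \<open>B\<close>, so its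
  homomorphism laws rest on the closure of that carrier.\<close>

lemma mv_isomorphic_inverse:
  assumes "mv_isomorphic B C"
    and closed: "\<And>x. x \<in> carrier B \<Longrightarrow> \<sim>\<^bsub>B\<^esub> x \<in> carrier B"
      "\<And>x y. x \<in> carrier B \<Longrightarrow> y \<in> carrier B \<Longrightarrow> x \<oplus>\<^bsub>B\<^esub> y \<in> carrier B" "\<zero>\<^bsub>B\<^esub> \<in> carrier B"
  obtains k where "k \<in> mv_hom C B" "k ` carrier C = carrier B"
proof -
  obtain h where h: "h \<in> mv_hom B C" "bij_betw h (carrier B) (carrier C)"
    using assms(1) unfolding mv_isomorphic_def by blast
  define k where "k = inv_into (carrier B) h"
  have kB: "k y \<in> carrier B" if "y \<in> carrier C" for y
    using that h(2) by (auto simp: k_def bij_betw_def intro: inv_into_into)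
  have hk: "h (k y) = y" if "y \<in> carrier C" for y
    using that h(2) by (simp add: k_def bij_betw_inv_into_right)
  have kh: "k (h x) = x" if "x \<in> carrier B" for x
    using that h(2) by (simp add: k_def bij_betw_inv_into_left)
  have hom: "h \<zero>\<^bsub>B\<^esub> = \<zero>\<^bsub>C\<^esub>" "\<And>x. x \<in> carrier B \<Longrightarrow> h (\<sim>\<^bsub>B\<^esub> x) = \<sim>\<^bsub>C\<^esub> (h x)"
    "\<And>x y. x \<in> carrier B \<Longrightarrow> y \<in> carrier B \<Longrightarrow> h (x \<oplus>\<^bsub>B\<^esub> y) = h x \<oplus>\<^bsub>C\<^esub> h y"
    using h(1) by (auto simp: mv_hom_def)
  have "k \<in> mv_hom C B"
    unfolding mv_hom_def
  proof (intro CollectI conjI ballI)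
    show "k \<in> carrier C \<rightarrow> carrier B" using kB by blast
    show "k \<zero>\<^bsub>C\<^esub> = \<zero>\<^bsub>B\<^esub>" using kh[OF closed(3)] hom(1) by simp
    show "k (\<sim>\<^bsub>C\<^esub> x) = \<sim>\<^bsub>B\<^esub> (k x)" if x: "x \<in> carrier C" for x
      using kh[OF closed(1)[OF kB[OF x]]] hom(2)[OF kB[OF x]] hk[OF x] by simp
    show "k (x \<oplus>\<^bsub>C\<^esub> y) = k x \<oplus>\<^bsub>B\<^esub> k y" if xy: "x \<in> carrier C" "y \<in> carrier C" for x y
      using kh[OF closed(2)[OF kB[OF xy(1)] kB[OF xy(2)]]] hom(3)[OF kB[OF xy(1)] kB[OF xy(2)]]
        hk[OF xy(1)] hk[OF xy(2)] by simp
  qed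
  moreover have "k ` carrier C = carrier B"
  proof
    show "k ` carrier C \<subseteq> carrier B" using kB by blast
    have "h x \<in> carrier C" if "x \<in> carrier B" for x using h(1) that by (auto simp: mv_hom_def)
    then show "carrier B \<subseteq> k ` carrier C" using kh by (metis image_eqI subsetI)
  qed
  ultimately show ?thesis using that by blast
qed

text \<open>A copy along \<iota> of a subset of the standard MV-algebra. The whole unit interval may
  not fit into an infinite type, but a countable subalgebra does.\<close>

definition mv_transport :: "(real \<Rightarrow> 'c) \<Rightarrow> real set \<Rightarrow> 'c mv_structure" where
  "mv_transport \<iota> D = \<lparr>carrier = \<iota> ` D,
     mv_plus = (\<lambda>x y. \<iota> (min 1 (inv_into D \<iota> x + inv_into D \<iota> y))),
     mv_neg = (\<lambda>x. \<iota> (1 - inv_into D \<iota> x)),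
     mv_zero = \<iota> 0\<rparr>"

lemma mv_algebra_mv_transport:
  assumes inj: "inj_on \<iota> D" and D: "D \<subseteq> {0..1}" "0 \<in> D" "\<And>x. x \<in> D \<Longrightarrow> 1 - x \<in> D"
    "\<And>x y. x \<in> D \<Longrightarrow> y \<in> D \<Longrightarrow> min 1 (x + y) \<in> D"
  shows "mv_algebra (mv_transport \<iota> D)"
proof -
  have b: "0 \<le> x" "x \<le> 1" if "x \<in> D" for x using D(1) that by auto
  have one: "1 - 0 \<in> D" using D(3)[OF D(2)] .
  let ?T = "mv_transport \<iota> D"
  have T: "carrier ?T = \<iota> ` D" "\<zero>\<^bsub>?T\<^esub> = \<iota> 0"
    "\<And>a b. a \<in> D \<Longrightarrow> b \<in> D \<Longrightarrow> \<iota> a \<oplus>\<^bsub>?T\<^esub> \<iota> b = \<iota> (min 1 (a + b))"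
    "\<And>a. a \<in> D \<Longrightarrow> \<sim>\<^bsub>?T\<^esub> (\<iota> a) = \<iota> (1 - a)"
    using inv_into_f_f[OF inj] by (simp_all add: mv_transport_def)
  note T = T D(2-4) one[simplified]
  show ?thesis
  proof (standard, goal_cases)
    case (4 x y z)
    then obtain a b c where abc: "a \<in> D" "b \<in> D" "c \<in> D" "x = \<iota> a" "y = \<iota> b" "z = \<iota> c"
      by (auto simp: T)
    have "min 1 (min 1 (a + b) + c) = min 1 (a + min 1 (b + c))"
      using b[OF abc(1)] b[OF abc(3)] by (auto simp: min_def)
    then show ?case using abc by (simp add: T)
  next
    case (9 x y)
    then obtain a c where ac: "a \<in> D" "c \<in> D" "x = \<iota> a" "y = \<iota> c" by (auto simp: T)
    have "min 1 (1 - min 1 (1 - a + c) + c) = min 1 (1 - min 1 (1 - c + a) + a)"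
      by (auto simp: min_def)
    then show ?case using ac by (simp add: T)
  next
    case (8 x)
    then obtain a where a: "a \<in> D" "x = \<iota> a" by (auto simp: T)
    then show ?case using b[OF a(1)] by (simp add: T)
  next
    case (6 x)
    then obtain a where a: "a \<in> D" "x = \<iota> a" by (auto simp: T)
    then show ?case using b[OF a(1)] by (simp add: T)
  qed (auto simp: T add.commute)
qed

text \<open>Two points not separated by \<open>A\<close> give two evaluations agreeing on
  \<open>A\<close>. Their common target only has to contain the values at these two points, which
  lie in a countable group.\<close>

lemma epi_imp_separating:
  fixes P :: "(real^'n) set"
  assumes P: "P \<subseteq> unit_cube" and inf: "infinite (UNIV :: 'c set)"
    and epi: "epi_subalgebra TYPE('c) A (mcn_algebra P)"
  shows "separating P A"
proof (rule ccontr)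
  assume "\<not> separating P A"
  then obtain x y where xy: "x \<in> P" "y \<in> P" "x \<noteq> y" "\<And>f. f \<in> A \<Longrightarrow> f x = f y"
    unfolding separating_def by blast
  let ?M = "carrier (mcn_algebra P)"
  \<comment> \<open>Parametrises the group generated by \<open>1\<close> and the coordinates of both
    points. It contains the values of all McNaughton functions there, and its part in the unit
    interval is an MV-algebra.\<close>
  define lin :: "(int^'n) \<times> (int^'n) \<times> int \<Rightarrow> real" where
    "lin = (\<lambda>(a, a', b). (\<Sum>i\<in>UNIV. of_int (a $ i) * x $ i) + (\<Sum>i\<in>UNIV. of_int (a' $ i) * y $ i) + of_int b)"
  have lin_diff: "lin (a - a', b - b', c - c') = lin (a, b, c) - lin (a', b', c')" for a a' b b' c c'
    by (simp add: lin_def sum_subtractf algebra_simps)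
  have lin_add: "lin (a + a', b + b', c + c') = lin (a, b, c) + lin (a', b', c')" for a a' b b' c c'
    by (simp add: lin_def sum.distrib algebra_simps)
  have lin_const: "lin (0, 0, c) = of_int c" for c by (simp add: lin_def)
  define D where "D = range lin \<inter> {0..1}"
  have "countable D" unfolding D_def by (intro countable_Int1 countable_image) auto
  obtain \<nu> :: "nat \<Rightarrow> 'c" where \<nu>: "inj \<nu>" using inf unfolding infinite_iff_countable_subset by auto
  define \<iota> where "\<iota> = \<nu> \<circ> to_nat_on D"
  have inj: "inj_on \<iota> D"
    unfolding \<iota>_def using inj_on_to_nat_on[OF \<open>countable D\<close>] inj_on_subset[OF \<nu>]
    by (intro comp_inj_on) auto
  define C where "C = mv_transport \<iota> D"
  have one: "1 \<in> range lin" and zero: "0 \<in> range lin"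
    using lin_const[of 1] lin_const[of 0] by (metis of_int_1 rangeI, metis of_int_0 rangeI)
  have sub: "r - s \<in> range lin" if "r \<in> range lin" "s \<in> range lin" for r s
    using that lin_diff by (metis (no_types, opaque_lifting) image_iff prod_cases3 rangeI)
  have add: "r + s \<in> range lin" if "r \<in> range lin" "s \<in> range lin" for r s
    using that lin_add by (metis (no_types, opaque_lifting) image_iff prod_cases3 rangeI)
  have C: "mv_algebra C" unfolding C_def
  proof (rule mv_algebra_mv_transport[OF inj])
    show "D \<subseteq> {0..1}" "0 \<in> D" using zero by (auto simp: D_def)
    show "1 - r \<in> D" if "r \<in> D" for r using that sub[OF one, of r] by (auto simp: D_def)
    show "min 1 (r + s) \<in> D" if "r \<in> D" "s \<in> D" for r s
      using that add[of r s] one by (auto simp: D_def min_def)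
  qed
  have ev: "(\<lambda>f. \<iota> (f z)) \<in> mv_hom (mcn_algebra P) C" if z: "z \<in> {x, y}" for z
  proof -
    have zP: "z \<in> P" using z xy by blast
    have D: "f z \<in> D" if f: "f \<in> ?M" for f
    proof -
      obtain u where u: "mcnaughton u" "f = restrict u P" using f by (auto simp: mcn_algebra_def)
      then obtain p where "integer_affine p" "u z = p z"
        using zP P unfolding mcnaughton_def by blast
      then obtain a b where "u z = (\<Sum>i\<in>UNIV. of_int (a $ i) * z $ i) + of_int b"
        unfolding integer_affine_def by auto
      then have "u z = lin (a, 0, b) \<or> u z = lin (0, a, b)" using z by (auto simp: lin_def)
      then have "f z \<in> range lin" using u(2) zP by auto
      then show ?thesis using mcn_algebra_range[OF P f zP] by (simp add: D_def)
    qed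
    show ?thesis unfolding mv_hom_def C_def mv_transport_def
      using D zP inv_into_f_f[OF inj] by (auto simp: mcn_algebra_def)
  qed
  obtain i where i: "x $ i \<noteq> y $ i" using xy(3) by (auto simp: vec_eq_iff)
  have "\<iota> (f x) = \<iota> (f y)" if "f \<in> ?M" for f
  proof -
    have H: "\<forall>h\<in>mv_hom (mcn_algebra P) C. \<forall>g\<in>mv_hom (mcn_algebra P) C.
        (\<forall>a\<in>A. h a = g a) \<longrightarrow> (\<forall>b\<in>?M. h b = g b)"
      using epi C unfolding epi_subalgebra_def by blast
    have hx: "(\<lambda>f. \<iota> (f x)) \<in> mv_hom (mcn_algebra P) C"
      and hy: "(\<lambda>f. \<iota> (f y)) \<in> mv_hom (mcn_algebra P) C"
      by (rule ev, simp)+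
    have "\<forall>a\<in>A. \<iota> (a x) = \<iota> (a y)" using xy(4) by metis
    then show ?thesis using bspec[OF mp[OF bspec[OF bspec[OF H hx] hy]] that] by blast
  qed
  \<comment> \<open>The epi property forces the evaluations to agree also on a coordinate
    distinguishing the points, which contradicts injectivity of \<iota> on \<open>D\<close>.\<close>
  from this[OF coord_in_mcn_algebra[OF P, of i]] have eq: "\<iota> (x $ i) = \<iota> (y $ i)" using xy by simp
  have "x $ i \<in> D" "y $ i \<in> D"
  proof -
    have "x $ i = lin (axis i 1, 0, 0)" "y $ i = lin (0, axis i 1, 0)"
      by (simp_all add: lin_def sum_axis_mult)
    moreover have "x $ i \<in> {0..1}" "y $ i \<in> {0..1}" using xy(1,2) P by (auto simp: mem_box_cart subset_iff)
    ultimately show "x $ i \<in> D" "y $ i \<in> D" unfolding D_def by auto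
  qed
  then show False using inj_onD[OF inj eq] i by blast
qed

theorem theorem4p4:
  fixes P :: "(real^'n) set" and A :: "(real^'n \<Rightarrow> real) set"
  assumes "rational_polyhedron P"
    and "mv_subalgebra A (mcn_algebra P)"
    and "infinite (UNIV :: 'c set)"
  shows "(A = carrier (mcn_algebra P) \<longleftrightarrow>
            mv_isomorphic (mv_restrict (mcn_algebra P) A) (mcn_algebra P) \<and> separating P A)
       \<and> (A = carrier (mcn_algebra P) \<longleftrightarrow>
            mv_isomorphic (mv_restrict (mcn_algebra P) A) (mcn_algebra P) \<and>
            epi_subalgebra TYPE('c) A (mcn_algebra P))"
proof -
  let ?M = "mcn_algebra P"
  have cube: "P \<subseteq> unit_cube" using assms(1) by (simp add: rational_polyhedron_def)
  have full: "mv_isomorphic (mv_restrict ?M A) ?M" "separating P A"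
    "epi_subalgebra TYPE('c) A ?M" if A: "A = carrier ?M"
  proof -
    have "id \<in> mv_hom ?M ?M" by (simp add: mv_hom_def)
    then show "mv_isomorphic (mv_restrict ?M A) ?M"
      unfolding mv_isomorphic_def A by (intro bexI[of _ id]) auto
    show "separating P A" unfolding A by (rule separating_mcn_algebra[OF cube])
    show "epi_subalgebra TYPE('c) A ?M" using assms(2) unfolding epi_subalgebra_def A by blast
  qed
  have sep: "A = carrier ?M" if iso: "mv_isomorphic (mv_restrict ?M A) ?M" and "separating P A"
  proof -
    have A: "A \<subseteq> carrier ?M" using assms(2) by (simp add: mv_subalgebra_def)
    obtain k where k: "k \<in> mv_hom ?M (mv_restrict ?M A)" "k ` carrier ?M = A"
      using mv_isomorphic_inverse[OF iso] assms(2) by (auto simp: mv_subalgebra_def)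
    \<comment> \<open>The inverse isomorphism, viewed as an endomorphism of the full algebra with
      image \<open>A\<close>.\<close>
    have "k \<in> mv_hom ?M ?M" using k(1) A by (auto simp: mv_hom_def)
    then have "carrier ?M \<subseteq> A" using separating_image_full[OF assms(1)] \<open>separating P A\<close> k(2) by metis
    then show ?thesis using A by blast
  qed
  show ?thesis using full sep epi_imp_separating[OF cube assms(3)] by blast
qed

end
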